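(* Let $\mathbb{V}$ be any congruence modular variety. Then, for any algebra $Y$ in $\mathbb{V}$, the fiber $Pt_Y\mathbb{V}$ satisfies Axiom $\ast$.
   Context: $Pt_Y\mathbb{V}$ is the pointed category whose objects are the split epimorphisms $(f,s)$ in $\mathbb{V}$ with codomain $Y$ and given section $s$, and whose morphisms are the homomorphisms over $Y$ commuting with the sections. $R[f]$ denotes the kernel equivalence relation of $f$. For equivalence relations $R,T$ on an object $W$ of a finitely complete category: $R\square T$ is the object of quadruples $(x,y,t,z)$ with $xRy$, $tRz$, $xTt$, $yTz$; $R\times_1T$ is the object of triples $(x,y,z)$ with $xRyTz$; $\zeta_{R,T}:R\square T\to R\times_1T$ is $(x,y,t,z)\mapsto(x,y,z)$. A relation $(f,g):W\rightarrowtail X\times Z$ is difunctional when $R[f]\cap R[g]=\Delta_W$ and $\zeta_{R[f],R[g]}$ is an isomorphism. In a pointed category, a relation $(f,g):W\rightarrowtail X\times Z$ is right punctual when $g$ has a section $t$ with $ft=0$. A pointed finitely complete category satisfies Axiom $\ast$ when, for any right punctual difunctional relation $(\pi_0^X,\pi_1^Z):W\rightarrowtail X\times Z$ and any equivalence relation $T$ on $W$ in this category, the map $\zeta_{R[\pi_0^X],T}: R[\pi_0^X]\square T\to R[\pi_0^X]\times_1T$ is an extremal epimorphism. *)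

theory Defs
  imports "HOL-Algebra.Lattice" "HOL-Library.FuncSet"
begin

section \<open>Categories\<close>

record ('o, 'm) cat =
  Obj :: "'o set"
  Arr :: "'m set"
  Dom :: "'m \<Rightarrow> 'o"
  Cod :: "'m \<Rightarrow> 'o"
  Id  :: "'o \<Rightarrow> 'm"
  Comp :: "'m \<Rightarrow> 'm \<Rightarrow> 'm"  (infixl "\<odot>\<index>" 70)

definition Hom :: "('o, 'm) cat \<Rightarrow> 'o \<Rightarrow> 'o \<Rightarrow> 'm set" where
  "Hom C A B = {f \<in> Arr C. Dom C f = A \<and> Cod C f = B}"

locale category =
  fixes C :: "('o, 'm) cat" (structure)
  assumes Dom_Obj: "f \<in> Arr C \<Longrightarrow> Dom C f \<in> Obj C"
    and Cod_Obj: "f \<in> Arr C \<Longrightarrow> Cod C f \<in> Obj C"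
    and Id_Hom: "A \<in> Obj C \<Longrightarrow> Id C A \<in> Hom C A A"
    and Comp_Hom: "f \<in> Hom C A B \<Longrightarrow> g \<in> Hom C B D \<Longrightarrow> g \<odot> f \<in> Hom C A D"
    and Comp_Id: "f \<in> Hom C A B \<Longrightarrow> f \<odot> Id C A = f"
    and Id_Comp: "f \<in> Hom C A B \<Longrightarrow> Id C B \<odot> f = f"
    and Comp_assoc: "f \<in> Hom C A B \<Longrightarrow> g \<in> Hom C B D \<Longrightarrow> h \<in> Hom C D E \<Longrightarrow>
                       (h \<odot> g) \<odot> f = h \<odot> (g \<odot> f)"

definition iso_arr :: "('o, 'm) cat \<Rightarrow> 'm \<Rightarrow> bool" where
  "iso_arr C f \<longleftrightarrow> f \<in> Arr C \<and>
     (\<exists>g \<in> Hom C (Cod C f) (Dom C f).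
        g \<odot>\<^bsub>C\<^esub> f = Id C (Dom C f) \<and> f \<odot>\<^bsub>C\<^esub> g = Id C (Cod C f))"

definition mono_arr :: "('o, 'm) cat \<Rightarrow> 'm \<Rightarrow> bool" where
  "mono_arr C m \<longleftrightarrow> m \<in> Arr C \<and>
     (\<forall>A \<in> Obj C. \<forall>h \<in> Hom C A (Dom C m). \<forall>k \<in> Hom C A (Dom C m).
        m \<odot>\<^bsub>C\<^esub> h = m \<odot>\<^bsub>C\<^esub> k \<longrightarrow> h = k)"

definition epi_arr :: "('o, 'm) cat \<Rightarrow> 'm \<Rightarrow> bool" where
  "epi_arr C e \<longleftrightarrow> e \<in> Arr C \<and>
     (\<forall>B \<in> Obj C. \<forall>h \<in> Hom C (Cod C e) B. \<forall>k \<in> Hom C (Cod C e) B.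
        h \<odot>\<^bsub>C\<^esub> e = k \<odot>\<^bsub>C\<^esub> e \<longrightarrow> h = k)"

definition extremal_epi :: "('o, 'm) cat \<Rightarrow> 'm \<Rightarrow> bool" where
  "extremal_epi C e \<longleftrightarrow> epi_arr C e \<and>
     (\<forall>B \<in> Obj C. \<forall>g \<in> Hom C (Dom C e) B. \<forall>m \<in> Hom C B (Cod C e).
        mono_arr C m \<and> e = m \<odot>\<^bsub>C\<^esub> g \<longrightarrow> iso_arr C m)"

definition terminal_obj :: "('o, 'm) cat \<Rightarrow> 'o \<Rightarrow> bool" where
  "terminal_obj C Z \<longleftrightarrow> Z \<in> Obj C \<and> (\<forall>A \<in> Obj C. \<exists>!h. h \<in> Hom C A Z)"

definition initial_obj :: "('o, 'm) cat \<Rightarrow> 'o \<Rightarrow> bool" where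
  "initial_obj C Z \<longleftrightarrow> Z \<in> Obj C \<and> (\<forall>A \<in> Obj C. \<exists>!h. h \<in> Hom C Z A)"

definition zero_obj :: "('o, 'm) cat \<Rightarrow> 'o \<Rightarrow> bool" where
  "zero_obj C Z \<longleftrightarrow> terminal_obj C Z \<and> initial_obj C Z"

definition zero_arr :: "('o, 'm) cat \<Rightarrow> 'm \<Rightarrow> bool" where
  "zero_arr C h \<longleftrightarrow> h \<in> Arr C \<and>
     (\<exists>Z u v. zero_obj C Z \<and> u \<in> Hom C (Dom C h) Z \<and> v \<in> Hom C Z (Cod C h) \<and>
        h = v \<odot>\<^bsub>C\<^esub> u)"

definition is_pullback :: "('o, 'm) cat \<Rightarrow> 'm \<Rightarrow> 'm \<Rightarrow> 'm \<Rightarrow> 'm \<Rightarrow> bool" where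
  "is_pullback C f g p q \<longleftrightarrow>
     p \<in> Arr C \<and> Cod C p = Dom C f \<and> q \<in> Hom C (Dom C p) (Dom C g) \<and>
     f \<odot>\<^bsub>C\<^esub> p = g \<odot>\<^bsub>C\<^esub> q \<and>
     (\<forall>A \<in> Obj C. \<forall>a \<in> Hom C A (Dom C f). \<forall>b \<in> Hom C A (Dom C g).
        f \<odot>\<^bsub>C\<^esub> a = g \<odot>\<^bsub>C\<^esub> b \<longrightarrow>
        (\<exists>!h. h \<in> Hom C A (Dom C p) \<and> p \<odot>\<^bsub>C\<^esub> h = a \<and> q \<odot>\<^bsub>C\<^esub> h = b))"

locale finitely_complete_category = category +
  assumes ex_terminal: "\<exists>Z. terminal_obj C Z"
    and ex_pullback: "f \<in> Arr C \<Longrightarrow> g \<in> Arr C \<Longrightarrow> Cod C f = Cod C g \<Longrightarrow>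
                        \<exists>p q. is_pullback C f g p q"

locale pointed_finitely_complete_category = finitely_complete_category +
  assumes ex_zero: "\<exists>Z. zero_obj C Z"


section \<open>Internal relations\<close>

text \<open>
  A relation on \<open>W\<close> is a jointly monic span \<open>(r\<^sub>0, r\<^sub>1)\<close> of arrows into \<open>W\<close>.  Descriptions by
  elements (``the object of quadruples such that \dots'') are read for generalised elements,
  i.e. arrows \<open>A \<rightarrow> W\<close>, and the object so described is the one representing these tuples.
  Such objects are determined up to isomorphism only, so they are given by predicates, and
  notions built on them quantify over all choices.
\<close>

definition is_relation :: "('o, 'm) cat \<Rightarrow> 'o \<Rightarrow> 'o \<Rightarrow> 'o \<Rightarrow> 'm \<Rightarrow> 'm \<Rightarrow> bool" where
  "is_relation C W X Z f g \<longleftrightarrow> f \<in> Hom C W X \<and> g \<in> Hom C W Z \<and>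
     (\<forall>A \<in> Obj C. \<forall>h \<in> Hom C A W. \<forall>k \<in> Hom C A W.
        f \<odot>\<^bsub>C\<^esub> h = f \<odot>\<^bsub>C\<^esub> k \<and> g \<odot>\<^bsub>C\<^esub> h = g \<odot>\<^bsub>C\<^esub> k \<longrightarrow> h = k)"

text \<open>\<open>related C R x y\<close> is \<open>x R y\<close> for generalised elements \<open>x\<close>, \<open>y\<close>.\<close>

definition related :: "('o, 'm) cat \<Rightarrow> 'm \<times> 'm \<Rightarrow> 'm \<Rightarrow> 'm \<Rightarrow> bool" where
  "related C R x y \<longleftrightarrow>
     (\<exists>h \<in> Hom C (Dom C x) (Dom C (fst R)). fst R \<odot>\<^bsub>C\<^esub> h = x \<and> snd R \<odot>\<^bsub>C\<^esub> h = y)"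

definition equivalence_relation :: "('o, 'm) cat \<Rightarrow> 'o \<Rightarrow> 'm \<times> 'm \<Rightarrow> bool" where
  "equivalence_relation C W T \<longleftrightarrow>
     is_relation C (Dom C (fst T)) W W (fst T) (snd T) \<and>
     (\<forall>A \<in> Obj C. equiv (Hom C A W) {(x, y) \<in> Hom C A W \<times> Hom C A W. related C T x y})"

definition kernel_relation :: "('o, 'm) cat \<Rightarrow> 'm \<Rightarrow> 'm \<times> 'm \<Rightarrow> bool" where
  "kernel_relation C f R \<longleftrightarrow> is_pullback C f f (fst R) (snd R)"

definition is_intersection ::
  "('o, 'm) cat \<Rightarrow> 'o \<Rightarrow> 'm \<times> 'm \<Rightarrow> 'm \<times> 'm \<Rightarrow> 'm \<times> 'm \<Rightarrow> bool" where
  "is_intersection C W R T I \<longleftrightarrow>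
     is_relation C (Dom C (fst I)) W W (fst I) (snd I) \<and>
     (\<forall>A \<in> Obj C. \<forall>x \<in> Hom C A W. \<forall>y \<in> Hom C A W.
        related C I x y \<longleftrightarrow> related C R x y \<and> related C T x y)"

definition diagonal :: "('o, 'm) cat \<Rightarrow> 'o \<Rightarrow> 'm \<times> 'm" where
  "diagonal C W = (Id C W, Id C W)"

text \<open>\<open>P\<close> with projections \<open>x, y, t, z\<close> is \<open>R \<box> T\<close>.\<close>

definition is_box ::
  "('o, 'm) cat \<Rightarrow> 'o \<Rightarrow> 'm \<times> 'm \<Rightarrow> 'm \<times> 'm \<Rightarrow> 'o \<Rightarrow> 'm \<Rightarrow> 'm \<Rightarrow> 'm \<Rightarrow> 'm \<Rightarrow> bool" where
  "is_box C W R T P x y t z \<longleftrightarrow> P \<in> Obj C \<and>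
     x \<in> Hom C P W \<and> y \<in> Hom C P W \<and> t \<in> Hom C P W \<and> z \<in> Hom C P W \<and>
     related C R x y \<and> related C R t z \<and> related C T x t \<and> related C T y z \<and>
     (\<forall>A \<in> Obj C. \<forall>x' \<in> Hom C A W. \<forall>y' \<in> Hom C A W. \<forall>t' \<in> Hom C A W. \<forall>z' \<in> Hom C A W.
        related C R x' y' \<and> related C R t' z' \<and> related C T x' t' \<and> related C T y' z' \<longrightarrow>
        (\<exists>!h. h \<in> Hom C A P \<and> x \<odot>\<^bsub>C\<^esub> h = x' \<and> y \<odot>\<^bsub>C\<^esub> h = y' \<and>
              t \<odot>\<^bsub>C\<^esub> h = t' \<and> z \<odot>\<^bsub>C\<^esub> h = z'))"

text \<open>\<open>Q\<close> with projections \<open>x, y, z\<close> is \<open>R \<times>\<^sub>1 T\<close>.\<close>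

definition is_times1 ::
  "('o, 'm) cat \<Rightarrow> 'o \<Rightarrow> 'm \<times> 'm \<Rightarrow> 'm \<times> 'm \<Rightarrow> 'o \<Rightarrow> 'm \<Rightarrow> 'm \<Rightarrow> 'm \<Rightarrow> bool" where
  "is_times1 C W R T Q x y z \<longleftrightarrow> Q \<in> Obj C \<and>
     x \<in> Hom C Q W \<and> y \<in> Hom C Q W \<and> z \<in> Hom C Q W \<and>
     related C R x y \<and> related C T y z \<and>
     (\<forall>A \<in> Obj C. \<forall>x' \<in> Hom C A W. \<forall>y' \<in> Hom C A W. \<forall>z' \<in> Hom C A W.
        related C R x' y' \<and> related C T y' z' \<longrightarrow>
        (\<exists>!h. h \<in> Hom C A Q \<and> x \<odot>\<^bsub>C\<^esub> h = x' \<and> y \<odot>\<^bsub>C\<^esub> h = y' \<and> z \<odot>\<^bsub>C\<^esub> h = z'))"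

definition is_zeta :: "('o, 'm) cat \<Rightarrow> 'o \<Rightarrow> 'm \<times> 'm \<Rightarrow> 'm \<times> 'm \<Rightarrow> 'm \<Rightarrow> bool" where
  "is_zeta C W R T \<zeta> \<longleftrightarrow>
     (\<exists>P x y t z Q x' y' z'. is_box C W R T P x y t z \<and> is_times1 C W R T Q x' y' z' \<and>
        \<zeta> \<in> Hom C P Q \<and> x' \<odot>\<^bsub>C\<^esub> \<zeta> = x \<and> y' \<odot>\<^bsub>C\<^esub> \<zeta> = y \<and> z' \<odot>\<^bsub>C\<^esub> \<zeta> = z)"

definition difunctional :: "('o, 'm) cat \<Rightarrow> 'o \<Rightarrow> 'm \<Rightarrow> 'm \<Rightarrow> bool" where
  "difunctional C W f g \<longleftrightarrow>
     (\<forall>R S. kernel_relation C f R \<and> kernel_relation C g S \<longrightarrow>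
        is_intersection C W R S (diagonal C W) \<and>
        (\<forall>\<zeta>. is_zeta C W R S \<zeta> \<longrightarrow> iso_arr C \<zeta>))"

definition right_punctual :: "('o, 'm) cat \<Rightarrow> 'o \<Rightarrow> 'o \<Rightarrow> 'm \<Rightarrow> 'm \<Rightarrow> bool" where
  "right_punctual C W Z f g \<longleftrightarrow>
     (\<exists>t \<in> Hom C Z W. g \<odot>\<^bsub>C\<^esub> t = Id C Z \<and> zero_arr C (f \<odot>\<^bsub>C\<^esub> t))"

definition axiom_star :: "('o, 'm) cat \<Rightarrow> bool" where
  "axiom_star C \<longleftrightarrow> pointed_finitely_complete_category C \<and>
     (\<forall>W X Z f g T R \<zeta>.
        is_relation C W X Z f g \<and> right_punctual C W Z f g \<and> difunctional C W f g \<and>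
        equivalence_relation C W T \<and> kernel_relation C f R \<and> is_zeta C W R T \<zeta> \<longrightarrow>
        extremal_epi C \<zeta>)"


section \<open>The fibers of the fibration of points\<close>

text \<open>An object is a pair \<open>(f, s)\<close>; an arrow is a triple (domain, codomain, underlying arrow).\<close>

definition Pt :: "('o, 'm) cat \<Rightarrow> 'o \<Rightarrow> ('m \<times> 'm, ('m \<times> 'm) \<times> ('m \<times> 'm) \<times> 'm) cat" where
  "Pt C Y =
     (let Ob = {(f, s). f \<in> Arr C \<and> Cod C f = Y \<and> s \<in> Hom C Y (Dom C f) \<and>
                        f \<odot>\<^bsub>C\<^esub> s = Id C Y}
      in \<lparr> Obj = Ob,
           Arr = {((f, s), (f', s'), h). (f, s) \<in> Ob \<and> (f', s') \<in> Ob \<and>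
                    h \<in> Hom C (Dom C f) (Dom C f') \<and> f' \<odot>\<^bsub>C\<^esub> h = f \<and> h \<odot>\<^bsub>C\<^esub> s = s'},
           Dom = (\<lambda>(p, q, h). p),
           Cod = (\<lambda>(p, q, h). q),
           Id = (\<lambda>(f, s). ((f, s), (f, s), Id C (Dom C f))),
           Comp = (\<lambda>(q', r, k) (p, q, h). (p, r, k \<odot>\<^bsub>C\<^esub> h)) \<rparr>)"


section \<open>Varieties of algebras\<close>

text \<open>
  The arity of each operation symbol is given by \<open>ar\<close>; the interpretation of a symbol is
  relevant only on lists of the right length over the carrier.  Carriers may be empty.
\<close>

record ('f, 'u) algebra = "'u partial_object" +
  interp :: "'f \<Rightarrow> 'u list \<Rightarrow> 'u"

definition is_algebra :: "('f \<Rightarrow> nat) \<Rightarrow> ('f, 'u) algebra \<Rightarrow> bool" where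
  "is_algebra ar A \<longleftrightarrow>
     (\<forall>\<sigma> xs. length xs = ar \<sigma> \<and> set xs \<subseteq> carrier A \<longrightarrow> interp A \<sigma> xs \<in> carrier A)"

datatype 'f trm = Var nat | App 'f "'f trm list"

fun wf_trm :: "('f \<Rightarrow> nat) \<Rightarrow> 'f trm \<Rightarrow> bool" where
  "wf_trm ar (Var i) \<longleftrightarrow> True"
| "wf_trm ar (App \<sigma> ts) \<longleftrightarrow> length ts = ar \<sigma> \<and> (\<forall>t \<in> set ts. wf_trm ar t)"

fun eval_trm :: "('f, 'u) algebra \<Rightarrow> (nat \<Rightarrow> 'u) \<Rightarrow> 'f trm \<Rightarrow> 'u" where
  "eval_trm A v (Var i) = v i"
| "eval_trm A v (App \<sigma> ts) = interp A \<sigma> (map (eval_trm A v) ts)"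

definition satisfies :: "('f, 'u) algebra \<Rightarrow> ('f trm \<times> 'f trm) set \<Rightarrow> bool" where
  "satisfies A E \<longleftrightarrow>
     (\<forall>(s, t) \<in> E. \<forall>v. range v \<subseteq> carrier A \<longrightarrow> eval_trm A v s = eval_trm A v t)"

text \<open>
  HOL cannot quantify over types inside a formula, so the type \<open>'u\<close> serves as the universe of
  a variety: \<open>V\<close> consists of all models of its identities with carrier a subset of \<open>'u\<close>.
\<close>

definition variety :: "('f \<Rightarrow> nat) \<Rightarrow> ('f, 'u) algebra set \<Rightarrow> bool" where
  "variety ar V \<longleftrightarrow>
     (\<exists>E. (\<forall>(s, t) \<in> E. wf_trm ar s \<and> wf_trm ar t) \<and>
          V = {A. is_algebra ar A \<and> satisfies A E})"

text \<open>Homomorphisms are \<^term>\<open>undefined\<close> outside the carrier, so equality is equality on it.\<close>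

definition homomorphisms ::
  "('f \<Rightarrow> nat) \<Rightarrow> ('f, 'u) algebra \<Rightarrow> ('f, 'u) algebra \<Rightarrow> ('u \<Rightarrow> 'u) set" where
  "homomorphisms ar A B =
     {h \<in> carrier A \<rightarrow>\<^sub>E carrier B.
        \<forall>\<sigma> xs. length xs = ar \<sigma> \<and> set xs \<subseteq> carrier A \<longrightarrow>
               h (interp A \<sigma> xs) = interp B \<sigma> (map h xs)}"

definition alg_cat ::
  "('f \<Rightarrow> nat) \<Rightarrow> ('f, 'u) algebra set \<Rightarrow>
   (('f, 'u) algebra, ('f, 'u) algebra \<times> ('f, 'u) algebra \<times> ('u \<Rightarrow> 'u)) cat" where
  "alg_cat ar V =
     \<lparr> Obj = V,
       Arr = {(A, B, h). A \<in> V \<and> B \<in> V \<and> h \<in> homomorphisms ar A B},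
       Dom = (\<lambda>(A, B, h). A),
       Cod = (\<lambda>(A, B, h). B),
       Id = (\<lambda>A. (A, A, restrict id (carrier A))),
       Comp = (\<lambda>(B', D, k) (A, B, h). (A, D, compose (carrier A) k h)) \<rparr>"

definition congruence :: "('f \<Rightarrow> nat) \<Rightarrow> ('f, 'u) algebra \<Rightarrow> ('u \<times> 'u) set \<Rightarrow> bool" where
  "congruence ar A \<theta> \<longleftrightarrow> equiv (carrier A) \<theta> \<and>
     (\<forall>\<sigma> xs ys. length xs = ar \<sigma> \<and> list_all2 (\<lambda>x y. (x, y) \<in> \<theta>) xs ys \<longrightarrow>
        (interp A \<sigma> xs, interp A \<sigma> ys) \<in> \<theta>)"

definition congruence_lattice ::
  "('f \<Rightarrow> nat) \<Rightarrow> ('f, 'u) algebra \<Rightarrow> ('u \<times> 'u) set gorder" where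
  "congruence_lattice ar A = \<lparr> carrier = {\<theta>. congruence ar A \<theta>}, eq = (=), le = (\<subseteq>) \<rparr>"

locale modular_lattice = lattice +
  assumes modular: "x \<in> carrier L \<Longrightarrow> y \<in> carrier L \<Longrightarrow> z \<in> carrier L \<Longrightarrow> x \<sqsubseteq> z \<Longrightarrow>
                      x \<squnion> (y \<sqinter> z) = (x \<squnion> y) \<sqinter> z"

definition congruence_modular_variety :: "('f \<Rightarrow> nat) \<Rightarrow> ('f, 'u) algebra set \<Rightarrow> bool" where
  "congruence_modular_variety ar V \<longleftrightarrow>
     variety ar V \<and> (\<forall>A \<in> V. modular_lattice (congruence_lattice ar A))"

text \<open>
  The universe must be large enough to contain the finite limits, and the free algebras on
  finitely many generators, of a variety with operation symbols in \<open>'f\<close>.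
\<close>

definition adequate_universe :: "'f itself \<Rightarrow> 'u itself \<Rightarrow> bool" where
  "adequate_universe _ _ \<longleftrightarrow> infinite (UNIV :: 'u set) \<and> (\<exists>e :: 'f \<Rightarrow> 'u. inj e)"

end

theory Submission
  imports Defs
begin

text \<open>
  In \<open>Pt\<^sub>YV\<close> everything can be computed on elements, and the claim becomes: if \<open>f\<close>, \<open>g\<close> are jointly
  injective on \<open>W\<close> and any two elements of \<open>W\<close> over the same point of \<open>Y\<close> can be mixed to an element
  with the \<open>f\<close>-coordinate of one and the \<open>g\<close>-coordinate of the other (this is what
  difunctionality and right punctuality provide), then \<open>R[f]\<close> permutes with every congruence
  \<open>T\<close> contained in the kernel of \<open>W \<rightarrow> Y\<close>.

  Write elements of \<open>W\<close> as pairs of coordinates, and let \<open>(p, c) R[f] (p, d) T (q, e)\<close>.  For a term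
  \<open>m\<close> with \<open>m(x, y, y, x) = x\<close> one has
  \<open>(m(p, p, q, q), v) = m((p, v), (p, e), (q, e), (q, v)) T m((p, v), (p, e), (p, d), (q, v))\<close>, whose first
  coordinate is \<open>m(p, p, p, q)\<close>, and symmetrically in the other direction.  Hence the first coordinates
  occurring in the \<open>T\<close>-class of \<open>(p, c)\<close> contain, along a chain of Day terms from the first to the last
  variable, all \<open>m(p, p, q, q)\<close> and \<open>m(p, p, p, q)\<close>; the chain starts at \<open>p\<close> and ends at \<open>q\<close>.
  The Day terms come from the modular law in the congruence lattice of the algebra of term
  functions of \<open>W\<close>.
\<close>

section \<open>Algebras of a variety\<close>

text \<open>The mixing of coordinates comes from the shape of zero arrows in the fibre: such an
  arrow sends an element to the section value over its image in Y. If t is the section of g with ft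
  = 0, then f(t(g b)) depends only on the point of Y below b. Hence, for a and b over one point, t(g
  b) R[f] t(g a) R[g] a, and difunctionality exchanges the two steps, which yields an element with
  the f-coordinate of a and the g-coordinate of b. This needs a common point of Y; R[f] and T never
  leave the fibre over such a point, because the arrows of \<open>Pt\<close> preserve the
  projections.

  Two obstacles shape the rest. Carriers must be subsets of the fixed type \<open>'u\<close>, so
  every auxiliary algebra is a set of tuples or of term functions that is copied into
  \<open>'u\<close> along an injective coding. And the axiom speaks of generalised elements and of
  arbitrary representing objects; each of these is compared with a concrete subproduct, which serves
  as the test object that makes elements visible.\<close>

lemma homomorphisms_app:
  "h \<in> homomorphisms ar A B \<Longrightarrow> length xs = ar \<sigma> \<Longrightarrow> set xs \<subseteq> carrier A \<Longrightarrow>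
     h (interp A \<sigma> xs) = interp B \<sigma> (map h xs)"
  by (auto simp: homomorphisms_def)

lemma homomorphisms_mem: "h \<in> homomorphisms ar A B \<Longrightarrow> a \<in> carrier A \<Longrightarrow> h a \<in> carrier B"
  by (auto simp: homomorphisms_def)

lemma eval_closed:
  assumes "is_algebra ar A" "range v \<subseteq> carrier A" "wf_trm ar t"
  shows "eval_trm A v t \<in> carrier A"
  using assms(3)
proof (induction t)
  case (Var i)
  then show ?case using assms(2) by auto
next
  case (App \<sigma> ts)
  then have "set (map (eval_trm A v) ts) \<subseteq> carrier A" "length (map (eval_trm A v) ts) = ar \<sigma>"
    by auto
  then show ?case using assms(1) unfolding is_algebra_def by (metis eval_trm.simps(2))
qed

lemma eval_hom:
  assumes "is_algebra ar A" "h \<in> homomorphisms ar A B" "range v \<subseteq> carrier A" "wf_trm ar t"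
  shows "h (eval_trm A v t) = eval_trm B (h \<circ> v) t"
  using assms(4)
proof (induction t)
  case (App \<sigma> ts)
  have "set (map (eval_trm A v) ts) \<subseteq> carrier A"
    using App.prems eval_closed[OF assms(1,3)] by auto
  moreover have "map h (map (eval_trm A v) ts) = map (eval_trm B (h \<circ> v)) ts"
    using App by (auto simp: comp_def)
  ultimately show ?case
    using App.prems homomorphisms_app[OF assms(2), of "map (eval_trm A v) ts" \<sigma>]
    by (simp add: comp_def del: map_map)
qed auto

lemma eval_rel:
  assumes "\<And>\<sigma> xs ys. length xs = ar \<sigma> \<Longrightarrow> list_all2 (\<lambda>x y. (x, y) \<in> T) xs ys \<Longrightarrow>
             (interp A \<sigma> xs, interp A \<sigma> ys) \<in> T"
    and "\<And>i. (u i, v i) \<in> T" "wf_trm ar t"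
  shows "(eval_trm A u t, eval_trm A v t) \<in> T"
  using assms(3)
proof (induction t)
  case (App \<sigma> ts)
  then have "list_all2 (\<lambda>x y. (x, y) \<in> T) (map (eval_trm A u) ts) (map (eval_trm A v) ts)"
    by (auto simp: list_all2_conv_all_nth)
  then show ?case using assms(1)[of "map (eval_trm A u) ts"] App.prems by simp
qed (use assms(2) in auto)

text \<open>Homomorphisms commute with term evaluation, so both sides of an identity have equal
  images under every member of the family, and joint injectivity brings the equality back.
  Membership in a variety thus passes to subalgebras of products without a product algebra being
  formed.\<close>

lemma satisfies_separated:
  assumes A: "is_algebra ar A"
    and wf: "\<forall>(s, t) \<in> E. wf_trm ar s \<and> wf_trm ar t"
    and e: "\<And>i. i \<in> I \<Longrightarrow> e i \<in> homomorphisms ar A (M i)"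
    and M: "\<And>i. i \<in> I \<Longrightarrow> satisfies (M i) E"
    and sep: "\<And>a b. a \<in> carrier A \<Longrightarrow> b \<in> carrier A \<Longrightarrow> (\<And>i. i \<in> I \<Longrightarrow> e i a = e i b) \<Longrightarrow> a = b"
  shows "satisfies A E"
  unfolding satisfies_def
proof (intro ballI, clarify)
  fix s t and v :: "nat \<Rightarrow> _"
  assume st: "(s, t) \<in> E" and v: "range v \<subseteq> carrier A"
  have w: "wf_trm ar s" "wf_trm ar t" using wf st by auto
  show "eval_trm A v s = eval_trm A v t"
  proof (rule sep)
    fix i assume i: "i \<in> I"
    have "range (e i \<circ> v) \<subseteq> carrier (M i)"
      using homomorphisms_mem[OF e[OF i]] v by auto
    then show "e i (eval_trm A v s) = e i (eval_trm A v t)"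
      using M[OF i] st eval_hom[OF A e[OF i] v] w unfolding satisfies_def by fastforce
  qed (use eval_closed[OF A v] w in auto)
qed

text \<open>A whole product may be too large for \<open>'u\<close>, so only the subset
  \<open>B\<close> is coded, and its coordinatewise operations are carried over along
  \<open>j\<close>. The conclusion forgets the coding: the algebra is known only through its
  coordinate maps \<open>e i\<close>, which are jointly injective and realise exactly the tuples in
  \<open>B\<close>.\<close>

lemma subproduct_exists:
  fixes M :: "'i \<Rightarrow> ('f, 'u) algebra" and B :: "('i \<Rightarrow> 'u) set" and j :: "('i \<Rightarrow> 'u) \<Rightarrow> 'u"
  assumes V: "V = {A. is_algebra ar A \<and> satisfies A E}"
    and wf: "\<forall>(s, t) \<in> E. wf_trm ar s \<and> wf_trm ar t"
    and M: "\<And>i. i \<in> I \<Longrightarrow> M i \<in> V"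
    and B: "B \<subseteq> (\<Pi>\<^sub>E i\<in>I. carrier (M i))"
    and cl: "\<And>\<sigma> bs. length bs = ar \<sigma> \<Longrightarrow> set bs \<subseteq> B \<Longrightarrow>
               (\<lambda>i\<in>I. interp (M i) \<sigma> (map (\<lambda>b. b i) bs)) \<in> B"
    and j: "inj_on j B"
  obtains A e where "A \<in> V" "\<And>i. i \<in> I \<Longrightarrow> e i \<in> homomorphisms ar A (M i)"
    "\<And>a b. a \<in> carrier A \<Longrightarrow> b \<in> carrier A \<Longrightarrow> (\<And>i. i \<in> I \<Longrightarrow> e i a = e i b) \<Longrightarrow> a = b"
    "\<And>a. a \<in> carrier A \<Longrightarrow> (\<lambda>i\<in>I. e i a) \<in> B"
    "\<And>b. b \<in> B \<Longrightarrow> \<exists>a \<in> carrier A. \<forall>i\<in>I. e i a = b i"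
proof -
  define d where "d = inv_into B j"
  define A where "A = \<lparr>carrier = j ` B, interp = (\<lambda>\<sigma> xs. j (\<lambda>i\<in>I. interp (M i) \<sigma> (map (\<lambda>b. b i) (map d xs))))\<rparr>"
  define e where "e i = (\<lambda>a\<in>carrier A. d a i)" for i
  have d: "d (j b) = b" if "b \<in> B" for b using that j by (simp add: d_def)
  have dB: "d a \<in> B" if "a \<in> carrier A" for a using that d by (auto simp: A_def)
  have jd: "j (d a) = a" if "a \<in> carrier A" for a using that d by (auto simp: A_def)
  have cl': "(\<lambda>i\<in>I. interp (M i) \<sigma> (map (\<lambda>b. b i) (map d xs))) \<in> B"
    if "length xs = ar \<sigma>" "set xs \<subseteq> carrier A" for \<sigma> xs
    by (rule cl) (use that dB in auto)
  have alg: "is_algebra ar A"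
    using cl' by (auto simp: is_algebra_def A_def)
  have hom: "e i \<in> homomorphisms ar A (M i)" if i: "i \<in> I" for i
    unfolding homomorphisms_def
  proof (intro CollectI conjI allI impI)
    show "e i \<in> carrier A \<rightarrow>\<^sub>E carrier (M i)"
      using dB B i by (auto simp: e_def)
    fix \<sigma> xs assume xs: "length xs = ar \<sigma> \<and> set xs \<subseteq> carrier A"
    have "interp A \<sigma> xs \<in> carrier A" using alg xs by (auto simp: is_algebra_def)
    then have "e i (interp A \<sigma> xs) = d (interp A \<sigma> xs) i" by (simp add: e_def)
    also have "\<dots> = interp (M i) \<sigma> (map (\<lambda>b. b i) (map d xs))"
      using d[OF cl'] xs i by (simp add: A_def)
    also have "map (\<lambda>b. b i) (map d xs) = map (e i) xs"
      using xs by (auto simp: e_def)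
    finally show "e i (interp A \<sigma> xs) = interp (M i) \<sigma> (map (e i) xs)" .
  qed
  have eq: "(\<lambda>i\<in>I. e i a) = d a" if "a \<in> carrier A" for a
    using dB[OF that] B that by (fastforce simp: e_def PiE_iff extensional_def)
  have sep: "a = b" if "a \<in> carrier A" "b \<in> carrier A" "\<And>i. i \<in> I \<Longrightarrow> e i a = e i b" for a b
  proof -
    have "(\<lambda>i\<in>I. e i a) = (\<lambda>i\<in>I. e i b)" using that(3) by auto
    then show ?thesis using eq jd that(1,2) by metis
  qed
  have "satisfies A E"
    by (rule satisfies_separated[OF alg wf hom _ sep]) (use M V in auto)
  then have "A \<in> V" using V alg by simp
  moreover have "\<exists>a \<in> carrier A. \<forall>i\<in>I. e i a = b i" if "b \<in> B" for b
    using that d by (intro bexI[of _ "j b"]) (auto simp: e_def A_def)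
  moreover have "(\<lambda>i\<in>I. e i a) \<in> B" if "a \<in> carrier A" for a
    using eq[OF that] dB[OF that] by simp
  ultimately show thesis using hom sep by (intro that[of A e]) auto
qed

section \<open>Codings of lists and of terms inside an infinite universe\<close>

lemma list_inj_exists:
  assumes "infinite (UNIV :: 'u set)"
  obtains j :: "'u list \<Rightarrow> 'u" where "inj j"
proof -
  obtain p :: "'u \<times> 'u \<Rightarrow> 'u" where p: "inj p"
    using card_of_Times_same_infinite[OF assms] unfolding card_of_ordIso[symmetric]
    by (auto simp: bij_betw_def)
  obtain n :: "nat \<Rightarrow> 'u" where n: "inj n"
    using infinite_countable_subset[OF assms] by auto
  \<comment> \<open>The tags \<open>n 0\<close> and \<open>n 1\<close> in the first component tell
    the empty list from a nonempty one.\<close>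
  define j where "j xs = foldr (\<lambda>x a. p (n 1, p (x, a))) xs (p (n 0, n 0))" for xs
  have "xs = ys" if "j xs = j ys" for xs ys
    using that
  proof (induction xs arbitrary: ys)
    case Nil
    then show ?case by (cases ys) (simp_all add: j_def inj_eq[OF p] inj_eq[OF n])
  next
    case (Cons x xs)
    then show ?case by (cases ys) (simp_all add: j_def inj_eq[OF p] inj_eq[OF n])
  qed
  then show thesis using that by (metis injI)
qed

text \<open>The head of the coded list tags the constructor, \<open>n 0\<close> for variables and
  \<open>n 1\<close> for applications. Lists of every length are coded by the same \<open>j\<close>,
  so the arities may be unbounded.\<close>

fun encode_trm :: "('u list \<Rightarrow> 'u) \<Rightarrow> (nat \<Rightarrow> 'u) \<Rightarrow> ('f \<Rightarrow> 'u) \<Rightarrow> 'f trm \<Rightarrow> 'u" where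
  "encode_trm j n e (Var i) = j [n 0, n i]"
| "encode_trm j n e (App \<sigma> ts) = j (n 1 # e \<sigma> # map (encode_trm j n e) ts)"

lemma trm_inj_exists:
  assumes "adequate_universe TYPE('f) TYPE('u)"
  obtains c :: "'f trm \<Rightarrow> 'u" where "inj c"
proof -
  have inf: "infinite (UNIV :: 'u set)" using assms by (simp add: adequate_universe_def)
  obtain e :: "'f \<Rightarrow> 'u" where e: "inj e" using assms by (auto simp: adequate_universe_def)
  obtain j :: "'u list \<Rightarrow> 'u" where j: "inj j" using list_inj_exists[OF inf] .
  obtain n :: "nat \<Rightarrow> 'u" where n: "inj n" using infinite_countable_subset[OF inf] by auto
  have "s = t" if "encode_trm j n e s = encode_trm j n e t" for s t
    using that
  proof (induction s arbitrary: t)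
    case (Var i)
    then show ?case by (cases t) (simp_all add: inj_eq[OF j] inj_eq[OF n])
  next
    case (App \<sigma> ts)
    then obtain us where t: "t = App \<sigma> us"
      and m: "map (encode_trm j n e) ts = map (encode_trm j n e) us"
      by (cases t) (simp_all add: inj_eq[OF j] inj_eq[OF n] inj_eq[OF e])
    have l: "length ts = length us" using m by (metis length_map)
    moreover have "ts ! k = us ! k" if "k < length ts" for k
      using App.IH[OF nth_mem[OF that]] m that l by (metis nth_map)
    ultimately show ?case using t by (simp add: list_eq_iff_nth_eq)
  qed
  then show thesis using that by (metis injI)
qed

section \<open>Day terms and permutability\<close>

text \<open>Arguments are exchanged one at a time from the left: \<open>as\<close> collects the
  places already treated, and each exchange follows a path in \<open>r\<close>, with single-place
  compatibility at every edge. Paths of different lengths at different places therefore cause no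
  trouble.\<close>

lemma rtrancl_compatible:
  assumes c: "\<And>as x y xs. (x, y) \<in> r \<Longrightarrow> length as + length xs + 1 = n \<Longrightarrow> set as \<subseteq> S \<Longrightarrow> set xs \<subseteq> S \<Longrightarrow>
               (h (as @ x # xs), h (as @ y # xs)) \<in> r\<^sup>*"
    and rS: "r \<subseteq> S \<times> S"
    and l: "list_all2 (\<lambda>x y. (x, y) \<in> r\<^sup>*) xs ys" "length xs = n" "set xs \<subseteq> S"
  shows "(h xs, h ys) \<in> r\<^sup>*"
proof -
  have "(h (as @ xs), h (as @ ys)) \<in> r\<^sup>*"
    if "list_all2 (\<lambda>x y. (x, y) \<in> r\<^sup>*) xs ys" "set xs \<subseteq> S" "set as \<subseteq> S" "length as + length xs = n"
    for as xs ys
    using that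
  proof (induction xs ys arbitrary: as rule: list_all2_induct)
    case (Cons x xs y ys)
    have xy: "(x, y) \<in> r\<^sup>*" by fact
    then have "y \<in> S" using rS Cons.prems(1) by (auto elim: rtranclE)
    have "(h (as @ x # xs), h (as @ y # xs)) \<in> r\<^sup>*"
      using xy
    proof (induction rule: rtrancl_induct)
      case (step z w)
      have "(h (as @ z # xs), h (as @ w # xs)) \<in> r\<^sup>*"
        using c[OF step(2)] Cons.prems by auto
      then show ?case using step(3) by auto
    qed auto
    also have "(h (as @ y # xs), h (as @ y # ys)) \<in> r\<^sup>*"
      using Cons.IH[of "as @ [y]"] Cons.prems \<open>y \<in> S\<close> by auto
    finally show ?case .
  qed auto
  from this[of xs ys "[]"] l show ?thesis by simp
qed

lemma congruence_single_step:
  assumes "congruence ar A \<theta>" "(x, y) \<in> \<theta>" "length as + length xs + 1 = ar \<sigma>"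
    "set as \<subseteq> carrier A" "set xs \<subseteq> carrier A"
  shows "(interp A \<sigma> (as @ x # xs), interp A \<sigma> (as @ y # xs)) \<in> \<theta>"
proof -
  have "refl_on (carrier A) \<theta>" using assms(1) by (simp add: congruence_def equiv_def)
  then have "list_all2 (\<lambda>x y. (x, y) \<in> \<theta>) (as @ x # xs) (as @ y # xs)"
    using assms(2,4,5)
    by (auto intro!: list_all2_appendI simp: list.rel_refl_strong refl_on_def subset_iff)
  then show ?thesis using assms(1,3) by (auto simp: congruence_def)
qed

text \<open>\<open>rtrancl\<close> is reflexive on the whole type, which is why it is cut down to
  the carrier. Compatibility in a single place survives the union of two congruences, compatibility
  in all places at once does not; the closure regains the latter.\<close>

lemma congruence_join:
  assumes A: "is_algebra ar A" and \<theta>: "congruence ar A \<theta>" and \<eta>: "congruence ar A \<eta>"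
  shows "congruence ar A ((\<theta> \<union> \<eta>)\<^sup>* \<inter> carrier A \<times> carrier A)"
proof -
  have e: "equiv (carrier A) \<theta>" "equiv (carrier A) \<eta>" using \<theta> \<eta> by (auto simp: congruence_def)
  then have sub: "\<theta> \<union> \<eta> \<subseteq> carrier A \<times> carrier A" by (auto simp: equiv_def)
  have "sym (\<theta> \<union> \<eta>)" using e by (auto simp: equiv_def sym_def)
  then have "sym ((\<theta> \<union> \<eta>)\<^sup>*)" by (rule sym_rtrancl)
  then have eq: "equiv (carrier A) ((\<theta> \<union> \<eta>)\<^sup>* \<inter> carrier A \<times> carrier A)"
    by (auto simp: equiv_def refl_on_def sym_def trans_def)
  have "(interp A \<sigma> xs, interp A \<sigma> ys) \<in> (\<theta> \<union> \<eta>)\<^sup>* \<inter> carrier A \<times> carrier A"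
    if len: "length xs = ar \<sigma>" and l: "list_all2 (\<lambda>x y. (x, y) \<in> (\<theta> \<union> \<eta>)\<^sup>* \<inter> carrier A \<times> carrier A) xs ys"
    for \<sigma> xs ys
  proof -
    have s: "set xs \<subseteq> carrier A" "set ys \<subseteq> carrier A" "length ys = ar \<sigma>"
      using l len by (auto simp: list_all2_conv_all_nth in_set_conv_nth)
    have "(interp A \<sigma> xs, interp A \<sigma> ys) \<in> (\<theta> \<union> \<eta>)\<^sup>*"
    proof (rule rtrancl_compatible[where h = "interp A \<sigma>" and n = "ar \<sigma>", OF _ sub _ len s(1)])
      show "list_all2 (\<lambda>x y. (x, y) \<in> (\<theta> \<union> \<eta>)\<^sup>*) xs ys"
        using l by (auto elim: list_all2_mono)
    qed (use congruence_single_step[OF \<theta>] congruence_single_step[OF \<eta>] in blast)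
    then show ?thesis using A s len by (auto simp: is_algebra_def)
  qed
  then show ?thesis using eq by (auto simp: congruence_def)
qed

lemma congruence_Int:
  assumes "congruence ar A \<theta>" "congruence ar A \<eta>"
  shows "congruence ar A (\<theta> \<inter> \<eta>)"
proof -
  have "equiv (carrier A) (\<theta> \<inter> \<eta>)"
    using assms by (auto simp: congruence_def equiv_def refl_on_def intro: sym_Int trans_Int)
  moreover have "list_all2 (\<lambda>x y. (x, y) \<in> \<theta>) xs ys" "list_all2 (\<lambda>x y. (x, y) \<in> \<eta>) xs ys"
    if "list_all2 (\<lambda>x y. (x, y) \<in> \<theta> \<inter> \<eta>) xs ys" for xs ys
    using that by (auto elim: list_all2_mono)
  ultimately show ?thesis using assms unfolding congruence_def by blast
qed

text \<open>The path x, y, z, w puts (x, w) into (\<gamma> join \<alpha>) meet \<beta>, which the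
  modular law turns into \<gamma> join (\<alpha> meet \<beta>). The lattice operations are known
  only by their universal properties, so they are compared by inclusion with intersections and
  transitive closures, which are congruences.\<close>

lemma modular_chain:
  assumes A: "is_algebra ar A" and mod: "modular_lattice (congruence_lattice ar A)"
    and c: "congruence ar A \<alpha>" "congruence ar A \<beta>" "congruence ar A \<gamma>" and "\<gamma> \<subseteq> \<beta>"
    and xy: "(x, y) \<in> \<alpha>" "(y, z) \<in> \<gamma>" "(z, w) \<in> \<alpha>" "(x, w) \<in> \<beta>"
  shows "(x, w) \<in> (\<gamma> \<union> \<alpha> \<inter> \<beta>)\<^sup>*"
proof -
  interpret modular_lattice "congruence_lattice ar A" by (rule mod)
  let ?L = "congruence_lattice ar A"
  have carr [simp]: "\<theta> \<in> carrier ?L \<longleftrightarrow> congruence ar A \<theta>" for \<theta>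
    by (simp add: congruence_lattice_def)
  have le [simp]: "\<theta> \<sqsubseteq>\<^bsub>?L\<^esub> \<eta> \<longleftrightarrow> \<theta> \<subseteq> \<eta>" for \<theta> \<eta> by (simp add: congruence_lattice_def)
  have m: "\<gamma> \<squnion>\<^bsub>?L\<^esub> (\<alpha> \<sqinter>\<^bsub>?L\<^esub> \<beta>) = (\<gamma> \<squnion>\<^bsub>?L\<^esub> \<alpha>) \<sqinter>\<^bsub>?L\<^esub> \<beta>"
    using modular[of \<gamma> \<alpha> \<beta>] c \<open>\<gamma> \<subseteq> \<beta>\<close> by simp
  have j: "congruence ar A (\<gamma> \<squnion>\<^bsub>?L\<^esub> \<alpha>)" using join_closed[of \<gamma> \<alpha>] c by simp
  have "\<gamma> \<subseteq> \<gamma> \<squnion>\<^bsub>?L\<^esub> \<alpha>" "\<alpha> \<subseteq> \<gamma> \<squnion>\<^bsub>?L\<^esub> \<alpha>" using join_left[of \<gamma> \<alpha>] join_right[of \<gamma> \<alpha>] c by simp_all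
  moreover have "trans (\<gamma> \<squnion>\<^bsub>?L\<^esub> \<alpha>)" using j by (auto simp: congruence_def equiv_def)
  ultimately have "(x, w) \<in> (\<gamma> \<squnion>\<^bsub>?L\<^esub> \<alpha>) \<inter> \<beta>"
    using xy by (meson IntI subsetD transD)
  also have "(\<gamma> \<squnion>\<^bsub>?L\<^esub> \<alpha>) \<inter> \<beta> \<subseteq> (\<gamma> \<squnion>\<^bsub>?L\<^esub> \<alpha>) \<sqinter>\<^bsub>?L\<^esub> \<beta>"
    using meet_le[of "(\<gamma> \<squnion>\<^bsub>?L\<^esub> \<alpha>) \<inter> \<beta>" "\<gamma> \<squnion>\<^bsub>?L\<^esub> \<alpha>" \<beta>] congruence_Int[OF j c(2)] j c by simp
  also have "\<dots> = \<gamma> \<squnion>\<^bsub>?L\<^esub> (\<alpha> \<sqinter>\<^bsub>?L\<^esub> \<beta>)" using m by simp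
  also have "\<dots> \<subseteq> (\<gamma> \<union> \<alpha> \<inter> \<beta>)\<^sup>* \<inter> carrier A \<times> carrier A"
  proof -
    have i: "congruence ar A (\<alpha> \<sqinter>\<^bsub>?L\<^esub> \<beta>)" using meet_closed[of \<alpha> \<beta>] c by simp
    have "\<alpha> \<sqinter>\<^bsub>?L\<^esub> \<beta> \<subseteq> \<alpha> \<inter> \<beta>" using meet_left[of \<alpha> \<beta>] meet_right[of \<alpha> \<beta>] c by simp
    moreover have "\<gamma> \<subseteq> carrier A \<times> carrier A" "\<alpha> \<subseteq> carrier A \<times> carrier A"
      using c by (auto simp: congruence_def equiv_def)
    moreover have "congruence ar A ((\<gamma> \<union> \<alpha> \<inter> \<beta>)\<^sup>* \<inter> carrier A \<times> carrier A)"
      by (intro congruence_join congruence_Int A c)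
    ultimately show ?thesis
      using join_le[of \<gamma> "(\<gamma> \<union> \<alpha> \<inter> \<beta>)\<^sup>* \<inter> carrier A \<times> carrier A" "\<alpha> \<sqinter>\<^bsub>?L\<^esub> \<beta>"] c i by simp blast
  qed
  finally show ?thesis by auto
qed

text \<open>Every index from 3 on receives \<open>d\<close>, so a term in arbitrarily many variables
  can be read as a quaternary operation.\<close>

definition val4 :: "'u \<Rightarrow> 'u \<Rightarrow> 'u \<Rightarrow> 'u \<Rightarrow> nat \<Rightarrow> 'u" where
  "val4 a b c d n = (if n = 0 then a else if n = 1 then b else if n = 2 then c else d)"

text \<open>Consecutive terms of a chain of Day terms for the single algebra \<open>W\<close>.\<close>

definition day_step :: "('f \<Rightarrow> nat) \<Rightarrow> ('f, 'u) algebra \<Rightarrow> ('f trm \<times> 'f trm) set" where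
  "day_step ar W = {(s, t). wf_trm ar s \<and> wf_trm ar t \<and>
     (\<forall>a \<in> carrier W. \<forall>b \<in> carrier W. eval_trm W (val4 a b b a) s = a \<and> eval_trm W (val4 a b b a) t = a) \<and>
     ((\<forall>a \<in> carrier W. \<forall>b \<in> carrier W. \<forall>c \<in> carrier W.
         eval_trm W (val4 a b b c) s = eval_trm W (val4 a b b c) t) \<or>
      (\<forall>a \<in> carrier W. \<forall>b \<in> carrier W.
         eval_trm W (val4 a a b b) s = eval_trm W (val4 a a b b) t))}"

lemma congruence_kernel:
  assumes "is_algebra ar A" "\<And>i. i \<in> I \<Longrightarrow> e i \<in> homomorphisms ar A (M i)"
  shows "congruence ar A {(a, b) \<in> carrier A \<times> carrier A. \<forall>i\<in>I. e i a = e i b}" (is "congruence _ _ ?\<theta>")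
proof -
  have "(interp A \<sigma> xs, interp A \<sigma> ys) \<in> ?\<theta>"
    if len: "length xs = ar \<sigma>" and l: "list_all2 (\<lambda>x y. (x, y) \<in> ?\<theta>) xs ys" for \<sigma> xs ys
  proof -
    have s: "set xs \<subseteq> carrier A" "set ys \<subseteq> carrier A" "length ys = ar \<sigma>"
      using l len by (auto simp: list_all2_conv_all_nth in_set_conv_nth)
    have "map (e i) xs = map (e i) ys" if "i \<in> I" for i
      using l that by (auto simp: list_all2_conv_all_nth list_eq_iff_nth_eq)
    then show ?thesis
      using s len assms homomorphisms_app[OF assms(2)] by (auto simp: is_algebra_def)
  qed
  then show ?thesis
    by (auto simp: congruence_def equiv_def refl_on_def sym_def trans_def)
qed

text \<open>
  The modular law is applied to the kernels of the evaluations at \<open>(a, a, b, b)\<close>, \<open>(a, b, b, a)\<close> and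
  \<open>(a, b, b, c)\<close> on the algebra of term functions of \<open>W\<close>, which is a copy inside \<open>'u\<close> of a
  subalgebra of a power of \<open>W\<close>.
\<close>

lemma day_chain:
  fixes ar :: "'f \<Rightarrow> nat" and V :: "('f, 'u) algebra set"
  assumes adq: "adequate_universe TYPE('f) TYPE('u)" and mod: "congruence_modular_variety ar V"
    and W: "W \<in> V"
  shows "(Var 0, Var 3) \<in> (day_step ar W)\<^sup>*"
proof -
  obtain E where wfE: "\<forall>(s, t) \<in> E. wf_trm ar s \<and> wf_trm ar t"
    and V: "V = {A. is_algebra ar A \<and> satisfies A E}"
    using mod by (auto simp: congruence_modular_variety_def variety_def)
  have algW: "is_algebra ar W" using W V by simp
  obtain enc :: "'f trm \<Rightarrow> 'u" where enc: "inj enc" using trm_inj_exists[OF adq] .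
  define I where "I = {v :: nat \<Rightarrow> 'u. range v \<subseteq> carrier W}"
  define ev where "ev t = (\<lambda>v\<in>I. eval_trm W v t)" for t
  define B where "B = ev ` {t. wf_trm ar t}"
  \<comment> \<open>A term function is coded by a chosen term that represents it. Arbitrary
    functions on \<open>I\<close> may outnumber the elements of \<open>'u\<close>, but terms do
    not.\<close>
  define j where "j b = enc (inv_into {t. wf_trm ar t} ev b)" for b
  have j: "inj_on j B"
    unfolding j_def B_def by (intro inj_onI) (metis enc f_inv_into_f injD)
  have BPi: "B \<subseteq> (\<Pi>\<^sub>E v\<in>I. carrier W)"
    unfolding B_def ev_def using eval_closed[OF algW]
    by (intro image_subsetI) (auto simp: restrict_PiE_iff I_def)
  have cl: "(\<lambda>v\<in>I. interp W \<sigma> (map (\<lambda>b. b v) bs)) \<in> B" if bs: "length bs = ar \<sigma>" "set bs \<subseteq> B" for \<sigma> bs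
  proof -
    \<comment> \<open>Representing terms are chosen for the arguments; \<sigma> applied to these
      terms represents the pointwise result.\<close>
    define ts where "ts = map (inv_into {t. wf_trm ar t} ev) bs"
    have "ev (inv_into {t. wf_trm ar t} ev b) = b" "wf_trm ar (inv_into {t. wf_trm ar t} ev b)"
      if "b \<in> set bs" for b
      using that bs(2) f_inv_into_f[of b ev "{t. wf_trm ar t}"] inv_into_into[of b ev "{t. wf_trm ar t}"]
      by (auto simp: B_def)
    then have "map ev ts = bs" and wf: "wf_trm ar (App \<sigma> ts)"
      using bs(1) by (auto simp: ts_def map_idI)
    have "(\<lambda>v\<in>I. interp W \<sigma> (map (\<lambda>b. b v) bs)) = ev (App \<sigma> ts)"
      unfolding \<open>map ev ts = bs\<close>[symmetric] by (auto simp: ev_def comp_def fun_eq_iff)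
    then show ?thesis using wf by (auto simp: B_def)
  qed
  obtain F e where F: "F \<in> V" and e: "\<And>v. v \<in> I \<Longrightarrow> e v \<in> homomorphisms ar F W"
    and eB: "\<And>a. a \<in> carrier F \<Longrightarrow> (\<lambda>v\<in>I. e v a) \<in> B"
    and Be: "\<And>b. b \<in> B \<Longrightarrow> \<exists>a \<in> carrier F. \<forall>v\<in>I. e v a = b v"
    by (rule subproduct_exists[OF V wfE _ BPi cl j]) (use W in auto)
  have algF: "is_algebra ar F" and modF: "modular_lattice (congruence_lattice ar F)"
    using F V mod by (auto simp: congruence_modular_variety_def)
  have rep: "\<exists>t. wf_trm ar t \<and> (\<forall>v\<in>I. e v a = eval_trm W v t)" if "a \<in> carrier F" for a
    using eB[OF that] by (auto simp: B_def ev_def fun_eq_iff) metis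
  have "\<exists>a \<in> carrier F. \<forall>v\<in>I. e v a = v i" for i
  proof -
    have "ev (Var i) \<in> B" by (simp add: B_def)
    then obtain a where "a \<in> carrier F" "\<forall>v\<in>I. e v a = ev (Var i) v" using Be by blast
    then show ?thesis by (auto simp: ev_def)
  qed
  then obtain x where xF: "x i \<in> carrier F" and x: "\<And>v. v \<in> I \<Longrightarrow> e v (x i) = v i" for i
    by metis
  define ker where "ker K = {(a, b) \<in> carrier F \<times> carrier F. \<forall>v\<in>K. e v a = e v b}" for K
  define Ka where "Ka = {val4 a a b b | a b. a \<in> carrier W \<and> b \<in> carrier W}"
  define Kb where "Kb = {val4 a b b a | a b. a \<in> carrier W \<and> b \<in> carrier W}"
  define Kc where "Kc = {val4 a b b c | a b c. a \<in> carrier W \<and> b \<in> carrier W \<and> c \<in> carrier W}"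
  have KI: "Ka \<subseteq> I" "Kb \<subseteq> I" "Kc \<subseteq> I"
    by (auto simp: Ka_def Kb_def Kc_def I_def val4_def)
  have kc: "congruence ar F (ker K)" if "K \<subseteq> I" for K
    unfolding ker_def by (rule congruence_kernel[OF algF]) (use e that in auto)
  have "Kb \<subseteq> Kc" by (auto simp: Kb_def Kc_def)
  have vx: "e v (x i) = v i" if "v \<in> Ka \<union> Kb \<union> Kc" for v i
    using x that KI by auto
  \<comment> \<open>The path consists of the variables: 0 and 1 as well as 2 and 3 coincide at (a,
    a, b, b), the variables 1 and 2 at (a, b, b, c), and 0 and 3 at (a, b, b, a).\<close>
  have "(x 0, x 3) \<in> (ker Kc \<union> ker Ka \<inter> ker Kb)\<^sup>*"
  proof (rule modular_chain[OF algF modF])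
    show "ker Kc \<subseteq> ker Kb" using \<open>Kb \<subseteq> Kc\<close> by (auto simp: ker_def)
    show "(x 0, x 1) \<in> ker Ka" "(x 1, x 2) \<in> ker Kc" "(x 2, x 3) \<in> ker Ka" "(x 0, x 3) \<in> ker Kb"
      using xF vx by (auto simp: ker_def) (auto simp: Ka_def Kb_def Kc_def val4_def)
  qed (use kc KI in auto)
  \<comment> \<open>Membership in \<open>ker Kb\<close> is carried along because it says m(a, b, b,
    a) = a for the current term m; it persists since \<open>ker Kc\<close> lies in
    \<open>ker Kb\<close>. The second part speaks of all terms that represent the current element,
    so that \<open>Var 3\<close> itself can be inserted at the end.\<close>
  then have "(x 0, x 3) \<in> ker Kb \<and>
     (\<forall>t. wf_trm ar t \<longrightarrow> (\<forall>v\<in>I. e v (x 3) = eval_trm W v t) \<longrightarrow> (Var 0, t) \<in> (day_step ar W)\<^sup>*)"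
  proof (induction rule: rtrancl_induct)
    case base
    have "(Var 0, t) \<in> day_step ar W" if t: "wf_trm ar t" "\<forall>v\<in>I. e v (x 0) = eval_trm W v t" for t
    proof -
      have ev0: "eval_trm W v t = v 0" if "v \<in> I" for v using t(2) x that by auto
      have *: "eval_trm W (val4 a b c d) t = a" if "{a, b, c, d} \<subseteq> carrier W" for a b c d
      proof -
        have "val4 a b c d \<in> I" using that by (auto simp: I_def val4_def)
        from ev0[OF this] have "eval_trm W (val4 a b c d) t = val4 a b c d 0" .
        then show ?thesis by (simp add: val4_def)
      qed
      show ?thesis using t(1) by (auto simp: day_step_def *) (auto simp: val4_def)
    qed
    then show ?case using xF by (auto simp: ker_def)
  next
    case (step y z)
    have yz: "(y, z) \<in> ker Kb" using step(2) \<open>Kb \<subseteq> Kc\<close> by (auto simp: ker_def)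
    then have yzF: "y \<in> carrier F" "z \<in> carrier F" by (auto simp: ker_def)
    obtain s where s: "wf_trm ar s" "\<forall>v\<in>I. e v y = eval_trm W v s" using rep[OF yzF(1)] by auto
    have "(x 0, z) \<in> ker Kb" using yz step(3) by (auto simp: ker_def)
    moreover have "(s, t) \<in> day_step ar W" if t: "wf_trm ar t" "\<forall>v\<in>I. e v z = eval_trm W v t" for t
    proof -
      have b: "eval_trm W v s = v 0 \<and> eval_trm W v t = v 0" if "v \<in> Kb" for v
      proof -
        have "v \<in> I" using that KI by auto
        then have "eval_trm W v s = e v y" "eval_trm W v t = e v z" using s t by auto
        moreover have "e v y = e v z" "e v (x 0) = e v y"
          using step(3) yz that by (auto simp: ker_def)
        ultimately show ?thesis using vx[of v 0] that by simp
      qed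
      have "(\<forall>v\<in>Kc. eval_trm W v s = eval_trm W v t) \<or> (\<forall>v\<in>Ka. eval_trm W v s = eval_trm W v t)"
      proof -
        have *: "eval_trm W v s = eval_trm W v t" if "e v y = e v z" "v \<in> Ka \<union> Kc" for v
        proof -
          have "v \<in> I" using that KI by auto
          then show ?thesis using s t that by metis
        qed
        from step(2) show ?thesis
        proof
          assume "(y, z) \<in> ker Kc"
          then show ?thesis using * by (auto simp: ker_def)
        next
          assume "(y, z) \<in> ker Ka \<inter> ker Kb"
          then show ?thesis using * by (auto simp: ker_def)
        qed
      qed
      moreover have "eval_trm W (val4 a b b a) s = a \<and> eval_trm W (val4 a b b a) t = a"
        if "a \<in> carrier W" "b \<in> carrier W" for a b
        using b[of "val4 a b b a"] that by (auto simp: Kb_def val4_def)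
      ultimately show ?thesis
        using s(1) t(1) unfolding day_step_def Ka_def Kc_def by simp blast
    qed
    ultimately show ?case using step(3) s by (meson rtrancl.rtrancl_into_rtrancl)
  qed
  then show ?thesis using x by auto
qed


section \<open>Permutability of R[f] with T along a chain of Day terms\<close>

lemma comp_val4: "h \<circ> val4 a b c d = val4 (h a) (h b) (h c) (h d)"
  by (auto simp: val4_def)

text \<open>The function \<open>p\<close> is the projection to the base, not the coordinate p of the
  overview. Coordinates can be mixed only between elements with equal \<open>p\<close>; by
  \<open>fp\<close> and \<open>Tp\<close> all elements that have to be mixed lie over one
  point.\<close>

lemma modular_permute:
  fixes ar :: "'f \<Rightarrow> nat" and V :: "('f, 'u) algebra set"
  assumes adq: "adequate_universe TYPE('f) TYPE('u)" and mod: "congruence_modular_variety ar V"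
    and W: "W \<in> V" and f: "f \<in> homomorphisms ar W X" and g: "g \<in> homomorphisms ar W Z"
    and inj: "\<And>a b. a \<in> carrier W \<Longrightarrow> b \<in> carrier W \<Longrightarrow> f a = f b \<Longrightarrow> g a = g b \<Longrightarrow> a = b"
    and full: "\<And>a b. a \<in> carrier W \<Longrightarrow> b \<in> carrier W \<Longrightarrow> p a = p b \<Longrightarrow> \<exists>c \<in> carrier W. f c = f a \<and> g c = g b"
    and fp: "\<And>a b. a \<in> carrier W \<Longrightarrow> b \<in> carrier W \<Longrightarrow> f a = f b \<Longrightarrow> p a = p b"
    and T: "equiv (carrier W) T"
    and comp: "\<And>\<sigma> xs ys. length xs = ar \<sigma> \<Longrightarrow> list_all2 (\<lambda>x y. (x, y) \<in> T) xs ys \<Longrightarrow>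
                 (interp W \<sigma> xs, interp W \<sigma> ys) \<in> T"
    and Tp: "\<And>a b. (a, b) \<in> T \<Longrightarrow> p a = p b"
    and xyz: "x \<in> carrier W" "y \<in> carrier W" "f x = f y" "(y, z) \<in> T"
  shows "\<exists>t \<in> carrier W. (x, t) \<in> T \<and> f t = f z"
proof -
  have algW: "is_algebra ar W"
    using W mod by (auto simp: congruence_modular_variety_def variety_def)
  have TW: "T \<subseteq> carrier W \<times> carrier W" and refl: "\<And>a. a \<in> carrier W \<Longrightarrow> (a, a) \<in> T"
    and sym: "\<And>a b. (a, b) \<in> T \<Longrightarrow> (b, a) \<in> T"
    and trans: "\<And>a b c. (a, b) \<in> T \<Longrightarrow> (b, c) \<in> T \<Longrightarrow> (a, c) \<in> T"
    using T by (auto simp: equiv_def refl_on_def sym_def dest: transD)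
  have z: "z \<in> carrier W" using xyz TW by auto
  have hom: "h (eval_trm W (val4 a b c d) m) = eval_trm M (val4 (h a) (h b) (h c) (h d)) m"
    if "h \<in> homomorphisms ar W M" "wf_trm ar m" "{a, b, c, d} \<subseteq> carrier W" for h M a b c d m
    using eval_hom[OF algW that(1) _ that(2), of "val4 a b c d"] that(3)
    by (auto simp: comp_val4) (auto simp: val4_def)
  have ecl: "eval_trm W (val4 a b c d) m \<in> carrier W"
    if "wf_trm ar m" "{a, b, c, d} \<subseteq> carrier W" for a b c d m
    by (rule eval_closed[OF algW]) (use that in \<open>auto simp: val4_def\<close>)
  have eT: "(eval_trm W (val4 a b c d) m, eval_trm W (val4 a b c' d) m) \<in> T"
    if "wf_trm ar m" "{a, b, d} \<subseteq> carrier W" "(c, c') \<in> T" for a b c c' d m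
    by (rule eval_rel[OF comp]) (use that refl in \<open>auto simp: val4_def\<close>)
  \<comment> \<open>\<open>P m b c\<close> says that the first coordinate of m(y, b, c, z) occurs in
    the \<open>T\<close>-class of x. It is used at (y, z) and (y, y), which fit the patterns (a, a,
    b, b) and (a, b, b, c) on which neighbouring Day terms agree.\<close>
  define P where "P m b c \<longleftrightarrow> (\<exists>v \<in> carrier W. (x, v) \<in> T \<and> f v = f (eval_trm W (val4 y b c z) m))" for m b c
  have aux: "\<exists>vp vq ep. {vp, vq, ep} \<subseteq> carrier W \<and> f vp = f y \<and> g vp = g v \<and> f vq = f z \<and> g vq = g v \<and>
              f ep = f y \<and> g ep = g z" if v: "v \<in> carrier W" "(x, v) \<in> T" for v
  proof -
    have "p y = p v" "p z = p v" "p y = p z" using fp[of x y] Tp xyz v by metis+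
    then show ?thesis
      using full[of y v] full[of z v] full[of y z] xyz z v by simp metis
  qed
  have switch: "P m y z \<longleftrightarrow> P m y y"
    if m: "wf_trm ar m" "\<forall>a \<in> carrier W. \<forall>b \<in> carrier W. eval_trm W (val4 a b b a) m = a" for m
  proof
    assume "P m y z"
    then obtain v where v: "v \<in> carrier W" "(x, v) \<in> T" "f v = f (eval_trm W (val4 y y z z) m)"
      by (auto simp: P_def)
    obtain vp vq ep where c: "{vp, vq, ep} \<subseteq> carrier W"
      "f vp = f y" "g vp = g v" "f vq = f z" "g vq = g v" "f ep = f y" "g ep = g z"
      using aux[OF v(1,2)] by blast
    \<comment> \<open>The mixed value equals v: in the second coordinate because m(v, z, z, v) = v
      holds in \<open>W\<close> and is pushed along g, in the first by the choice of v.\<close>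
    have "g (eval_trm W (val4 vp ep z vq) m) = g (eval_trm W (val4 v z z v) m)"
      using hom[OF g m(1)] c v z by simp
    moreover have "f (eval_trm W (val4 vp ep z vq) m) = f v"
      using hom[OF f m(1)] c v(3) z xyz by simp
    ultimately have "eval_trm W (val4 vp ep z vq) m = v"
      using m v z c ecl by (subst inj[of _ v]) auto
    \<comment> \<open>Only the third argument moves, from z to y along \<open>T\<close>; this
      changes the first coordinate from that of m(y, y, z, z) to that of m(y, y, y, z).\<close>
    moreover have "(eval_trm W (val4 vp ep z vq) m, eval_trm W (val4 vp ep y vq) m) \<in> T"
      by (rule eT[OF _ _ sym]) (use c xyz m in auto)
    moreover have "f (eval_trm W (val4 vp ep y vq) m) = f (eval_trm W (val4 y y y z) m)"
      using hom[OF f m(1)] c z xyz by simp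
    ultimately show "P m y y" using v(2) trans TW unfolding P_def by blast
  next
    assume "P m y y"
    then obtain v where v: "v \<in> carrier W" "(x, v) \<in> T" "f v = f (eval_trm W (val4 y y y z) m)"
      by (auto simp: P_def)
    obtain vp vq ep where c: "{vp, vq, ep} \<subseteq> carrier W"
      "f vp = f y" "g vp = g v" "f vq = f z" "g vq = g v" "f ep = f y" "g ep = g z"
      using aux[OF v(1,2)] by blast
    \<comment> \<open>In this direction the two middle arguments agree in both coordinates, so y
      itself can serve for both.\<close>
    have "g (eval_trm W (val4 vp y y vq) m) = g (eval_trm W (val4 v y y v) m)"
      using hom[OF g m(1)] c v xyz by simp
    moreover have "f (eval_trm W (val4 vp y y vq) m) = f v"
      using hom[OF f m(1)] c v(3) z xyz by simp
    ultimately have "eval_trm W (val4 vp y y vq) m = v"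
      using m v xyz c ecl by (subst inj[of _ v]) auto
    moreover have "(eval_trm W (val4 vp y y vq) m, eval_trm W (val4 vp y z vq) m) \<in> T"
      by (rule eT) (use c xyz m in auto)
    moreover have "f (eval_trm W (val4 vp y z vq) m) = f (eval_trm W (val4 y y z z) m)"
      using hom[OF f m(1)] c z xyz by simp
    ultimately show "P m y z" using v(2) trans TW unfolding P_def by blast
  qed
  have "(Var 0, Var 3) \<in> (day_step ar W)\<^sup>*" by (rule day_chain[OF adq mod W])
  then have "P (Var 3) y z"
  proof (induction rule: rtrancl_induct)
    case base
    show ?case using xyz refl by (auto simp: P_def val4_def)
  next
    case (step s t)
    then have "P s y z \<longleftrightarrow> P s y y" "P t y z \<longleftrightarrow> P t y y"
      by (intro switch; auto simp: day_step_def)+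
    \<comment> \<open>Agreement on (a, b, b, c), taken with a = b, transports \<open>P\<close> at
      (y, y); agreement on (a, a, b, b) transports it at (y, z). \<open>switch\<close> passes
      between the two.\<close>
    moreover have "P t y y = P s y y \<or> P t y z = P s y z"
      using step(2) xyz z by (auto simp: day_step_def P_def)
    ultimately show ?case using step(3) by blast
  qed
  then show ?thesis by (auto simp: P_def val4_def)
qed

section \<open>The fibre over an algebra, elementwise\<close>

type_synonym ('f, 'u) hom_arr = "('f, 'u) algebra \<times> ('f, 'u) algebra \<times> ('u \<Rightarrow> 'u)"
type_synonym ('f, 'u) point = "('f, 'u) hom_arr \<times> ('f, 'u) hom_arr"
type_synonym ('f, 'u) point_arr = "('f, 'u) point \<times> ('f, 'u) point \<times> ('f, 'u) hom_arr"

definition alg :: "('f, 'u) point \<Rightarrow> ('f, 'u) algebra" where "alg p = fst (fst p)"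
definition prj :: "('f, 'u) point \<Rightarrow> 'u \<Rightarrow> 'u" where "prj p = snd (snd (fst p))"
definition sec :: "('f, 'u) point \<Rightarrow> 'u \<Rightarrow> 'u" where "sec p = snd (snd (snd p))"
definition fn :: "('f, 'u) point_arr \<Rightarrow> 'u \<Rightarrow> 'u" where "fn h = snd (snd (snd (snd h)))"

abbreviation elems :: "('f, 'u) point \<Rightarrow> 'u set" where "elems p \<equiv> carrier (alg p)"

definition graph :: "('f, 'u) point_arr \<times> ('f, 'u) point_arr \<Rightarrow> ('u \<times> 'u) set" where
  "graph R = (\<lambda>d. (fn (fst R) d, fn (snd R) d)) ` elems (fst (fst R))"

text \<open>This makes \<open>S\<close> a subalgebra of the product of \<open>A\<close> and
  \<open>B\<close> without forming that product; for \<open>A\<close> = \<open>B\<close> it is the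
  compatibility clause of a congruence.\<close>

definition compatible :: "('f \<Rightarrow> nat) \<Rightarrow> ('f, 'u) algebra \<Rightarrow> ('f, 'u) algebra \<Rightarrow> ('u \<times> 'u) set \<Rightarrow> bool" where
  "compatible ar A B S \<longleftrightarrow> (\<forall>\<sigma> xs ys. length xs = ar \<sigma> \<and> list_all2 (\<lambda>x y. (x, y) \<in> S) xs ys \<longrightarrow>
     (interp A \<sigma> xs, interp B \<sigma> ys) \<in> S)"

lemma compatibleD:
  "compatible ar A B S \<Longrightarrow> length bs = ar \<sigma> \<Longrightarrow> (\<And>b. b \<in> set bs \<Longrightarrow> (f b, g b) \<in> S) \<Longrightarrow>
     (interp A \<sigma> (map f bs), interp B \<sigma> (map g bs)) \<in> S"
  unfolding compatible_def by (simp add: list_all2_conv_all_nth)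

text \<open>One index gives the underlying subalgebra of a pullback; equal families \<open>h\<close>
  and \<open>k\<close> give the joint kernel of the family.\<close>

lemma compatible_equalizer:
  assumes "is_algebra ar A" "is_algebra ar B"
    and "\<And>i. i \<in> I \<Longrightarrow> h i \<in> homomorphisms ar A (M i)" "\<And>i. i \<in> I \<Longrightarrow> k i \<in> homomorphisms ar B (M i)"
  shows "compatible ar A B {(a, b) \<in> carrier A \<times> carrier B. \<forall>i\<in>I. h i a = k i b}"
  unfolding compatible_def
proof (intro allI impI, elim conjE)
  fix \<sigma> xs ys
  assume len: "length xs = ar \<sigma>"
    and l: "list_all2 (\<lambda>x y. (x, y) \<in> {(a, b) \<in> carrier A \<times> carrier B. \<forall>i\<in>I. h i a = k i b}) xs ys"
  have s: "set xs \<subseteq> carrier A" "set ys \<subseteq> carrier B" "length ys = ar \<sigma>"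
    using l len by (auto simp: list_all2_conv_all_nth in_set_conv_nth)
  have "map (h i) xs = map (k i) ys" if "i \<in> I" for i
    using l that by (auto simp: list_all2_conv_all_nth list_eq_iff_nth_eq)
  then show "(interp A \<sigma> xs, interp B \<sigma> ys) \<in> {(a, b) \<in> carrier A \<times> carrier B. \<forall>i\<in>I. h i a = k i b}"
    using s len assms(1,2) homomorphisms_app[OF assms(3)] homomorphisms_app[OF assms(4)]
    by (auto simp: is_algebra_def)
qed

locale point_fibre =
  fixes ar :: "'f \<Rightarrow> nat" and V :: "('f, 'u) algebra set" and E :: "('f trm \<times> 'f trm) set"
    and Y :: "('f, 'u) algebra"
  assumes inf: "infinite (UNIV :: 'u set)"
    and wfE: "\<forall>(s, t) \<in> E. wf_trm ar s \<and> wf_trm ar t"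
    and V: "V = {A. is_algebra ar A \<and> satisfies A E}"
    and Y: "Y \<in> V"
begin

abbreviation C where "C \<equiv> Pt (alg_cat ar V) Y"

section \<open>Objects and arrows of the fibre described by elements\<close>

lemma is_algebra: "A \<in> V \<Longrightarrow> is_algebra ar A"
  using V by simp

lemma id_homomorphism: "A \<in> V \<Longrightarrow> restrict id (carrier A) \<in> homomorphisms ar A A"
  using V by (auto simp: homomorphisms_def is_algebra_def subset_iff intro!: arg_cong[of _ _ "interp A _"] map_idI[symmetric])

lemma compose_homomorphism:
  assumes "A \<in> V" "h \<in> homomorphisms ar A B" "k \<in> homomorphisms ar B D"
  shows "compose (carrier A) k h \<in> homomorphisms ar A D"
proof -
  have h: "h \<in> carrier A \<rightarrow> carrier B" and k: "k \<in> carrier B \<rightarrow> carrier D"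
    using assms by (auto simp: homomorphisms_def)
  have "compose (carrier A) k h (interp A \<sigma> xs) = interp D \<sigma> (map (compose (carrier A) k h) xs)"
    if xs: "length xs = ar \<sigma>" "set xs \<subseteq> carrier A" for \<sigma> xs
  proof -
    have "map (compose (carrier A) k h) xs = map k (map h xs)"
      using xs(2) by (auto simp: compose_def)
    moreover have "interp A \<sigma> xs \<in> carrier A" using assms(1) V xs by (auto simp: is_algebra_def)
    moreover have "set (map h xs) \<subseteq> carrier B" using h xs by auto
    ultimately show ?thesis
      using homomorphisms_app[OF assms(2) xs] homomorphisms_app[OF assms(3), of "map h xs" \<sigma>] xs
      by (simp add: compose_def del: map_map)
  qed
  then show ?thesis using h k by (auto simp: homomorphisms_def compose_def)
qed

lemma homomorphism_eqI:
  "h \<in> homomorphisms ar A B \<Longrightarrow> k \<in> homomorphisms ar A B \<Longrightarrow>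
     (\<And>a. a \<in> carrier A \<Longrightarrow> h a = k a) \<Longrightarrow> h = k"
  by (rule PiE_ext[of h "carrier A" "\<lambda>_. carrier B"]) (auto simp: homomorphisms_def)

lemma Hom_alg_cat:
  "h \<in> Hom (alg_cat ar V) A B \<longleftrightarrow>
     A \<in> V \<and> B \<in> V \<and> (\<exists>\<phi>. h = (A, B, \<phi>) \<and> \<phi> \<in> homomorphisms ar A B)"
  by (auto simp: Hom_def alg_cat_def)

lemma Comp_alg_cat: "(B', D, k) \<odot>\<^bsub>alg_cat ar V\<^esub> (A, B, h) = (A, D, compose (carrier A) k h)"
  by (simp add: alg_cat_def)

lemma compose_eq_iff:
  assumes "A \<in> V" "h \<in> homomorphisms ar A B" "k \<in> homomorphisms ar B D" "l \<in> homomorphisms ar A D"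
  shows "compose (carrier A) k h = l \<longleftrightarrow> (\<forall>a \<in> carrier A. k (h a) = l a)"
  using homomorphism_eqI[OF compose_homomorphism[OF assms(1-3)] assms(4)]
  by (auto simp: compose_def)

text \<open>Homomorphisms are extensional, so the equation between composites becomes a pointwise
  one. An object is then just an algebra with a projection and a section; the remaining clauses pin
  down the redundant components of the triples.\<close>

lemma Obj_iff:
  "p \<in> Obj C \<longleftrightarrow> fst (snd (fst p)) = Y \<and> fst (snd p) = Y \<and> fst (snd (snd p)) = alg p \<and>
     alg p \<in> V \<and> prj p \<in> homomorphisms ar (alg p) Y \<and> sec p \<in> homomorphisms ar Y (alg p) \<and>
     (\<forall>y \<in> carrier Y. prj p (sec p y) = y)"
proof -
  have "p \<in> Obj C \<longleftrightarrow> (\<exists>A \<phi> \<psi>. p = ((A, Y, \<phi>), (Y, A, \<psi>)) \<and> A \<in> V \<and>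
     \<phi> \<in> homomorphisms ar A Y \<and> \<psi> \<in> homomorphisms ar Y A \<and>
     compose (carrier Y) \<phi> \<psi> = restrict id (carrier Y))"
    using Y by (auto simp: Pt_def Let_def Hom_alg_cat) (auto simp: alg_cat_def)
  also have "\<dots> \<longleftrightarrow> (\<exists>A \<phi> \<psi>. p = ((A, Y, \<phi>), (Y, A, \<psi>)) \<and> A \<in> V \<and>
     \<phi> \<in> homomorphisms ar A Y \<and> \<psi> \<in> homomorphisms ar Y A \<and> (\<forall>y \<in> carrier Y. \<phi> (\<psi> y) = y))"
    using Y by (simp add: compose_eq_iff id_homomorphism cong: conj_cong)
  finally show ?thesis by (cases p) (auto simp: alg_def prj_def sec_def)
qed

lemma point_cases:
  assumes "p \<in> Obj C"
  obtains A \<phi> \<psi> where "p = ((A, Y, \<phi>), (Y, A, \<psi>))"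
  using assms that by (cases p) (auto simp: Obj_iff alg_def)

lemma Hom_iff:
  "h \<in> Hom C p q \<longleftrightarrow> p \<in> Obj C \<and> q \<in> Obj C \<and> fst h = p \<and> fst (snd h) = q \<and>
     fst (snd (snd h)) = alg p \<and> fst (snd (snd (snd h))) = alg q \<and> fn h \<in> homomorphisms ar (alg p) (alg q) \<and>
     (\<forall>a \<in> elems p. prj q (fn h a) = prj p a) \<and> (\<forall>y \<in> carrier Y. fn h (sec p y) = sec q y)"
proof (cases "p \<in> Obj C \<and> q \<in> Obj C")
  case True
  obtain A \<phi> \<psi> where p: "p = ((A, Y, \<phi>), (Y, A, \<psi>))" using True point_cases by blast
  obtain B \<phi>' \<psi>' where q: "q = ((B, Y, \<phi>'), (Y, B, \<psi>'))" using True point_cases by blast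
  have AB: "alg p = A" "prj p = \<phi>" "sec p = \<psi>" "alg q = B" "prj q = \<phi>'" "sec q = \<psi>'"
    by (simp_all add: p q alg_def prj_def sec_def)
  have o: "A \<in> V" "\<phi> \<in> homomorphisms ar A Y" "\<psi> \<in> homomorphisms ar Y A"
    "B \<in> V" "\<phi>' \<in> homomorphisms ar B Y" "\<psi>' \<in> homomorphisms ar Y B"
    using True by (simp_all add: Obj_iff AB)
  have "h \<in> Hom C p q \<longleftrightarrow> (\<exists>\<chi>. h = (p, q, A, B, \<chi>) \<and> \<chi> \<in> homomorphisms ar A B \<and>
      compose (carrier A) \<phi>' \<chi> = \<phi> \<and> compose (carrier Y) \<chi> \<psi> = \<psi>')"
  proof -
    have "h \<in> Hom C p q \<longleftrightarrow> (\<exists>k. h = (p, q, k) \<and> k \<in> Hom (alg_cat ar V) A B \<and>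
      (B, Y, \<phi>') \<odot>\<^bsub>alg_cat ar V\<^esub> k = (A, Y, \<phi>) \<and> k \<odot>\<^bsub>alg_cat ar V\<^esub> (Y, A, \<psi>) = (Y, B, \<psi>'))"
      using True by (auto simp: Hom_def Pt_def Let_def p q) (auto simp: alg_cat_def)
    then show ?thesis using o by (simp add: Hom_alg_cat) (auto simp: Comp_alg_cat)
  qed
  also have "\<dots> \<longleftrightarrow> (\<exists>\<chi>. h = (p, q, A, B, \<chi>) \<and> \<chi> \<in> homomorphisms ar A B \<and>
      (\<forall>a \<in> carrier A. \<phi>' (\<chi> a) = \<phi> a) \<and> (\<forall>y \<in> carrier Y. \<chi> (\<psi> y) = \<psi>' y))"
    using o Y by (simp add: compose_eq_iff cong: conj_cong)
  finally show ?thesis using True by (cases h) (auto simp: AB fn_def)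
next
  case False
  then show ?thesis by (auto simp: Hom_def Pt_def Let_def)
qed

lemma arrow_cases:
  assumes "h \<in> Hom C p q"
  obtains \<phi> where "h = (p, q, alg p, alg q, \<phi>)"
  using assms that by (cases h) (auto simp: Hom_iff)

lemma Hom_ArrD: "h \<in> Arr C \<Longrightarrow> h \<in> Hom C (Dom C h) (Cod C h)"
  by (simp add: Hom_def)

lemma Dom_eq: "Dom C h = fst h"
  by (auto simp: Pt_def Let_def split: prod.splits)

lemma HomD:
  assumes "h \<in> Hom C p q"
  shows "p \<in> Obj C" "q \<in> Obj C" "h \<in> Arr C" "Dom C h = p" "Cod C h = q" "fst h = p"
    "fn h \<in> homomorphisms ar (alg p) (alg q)"
    "a \<in> elems p \<Longrightarrow> fn h a \<in> elems q" "a \<in> elems p \<Longrightarrow> prj q (fn h a) = prj p a"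
    "y \<in> carrier Y \<Longrightarrow> fn h (sec p y) = sec q y"
proof -
  show "h \<in> Arr C" "Dom C h = p" "Cod C h = q" using assms by (auto simp: Hom_def)
  then show "fst h = p" by (simp add: Dom_eq)
qed (use assms homomorphisms_mem[of "fn h"] in \<open>simp_all add: Hom_iff, blast?\<close>)

lemma ObjD:
  assumes "p \<in> Obj C"
  shows "alg p \<in> V" "is_algebra ar (alg p)" "prj p \<in> homomorphisms ar (alg p) Y"
    "sec p \<in> homomorphisms ar Y (alg p)" "y \<in> carrier Y \<Longrightarrow> prj p (sec p y) = y"
    "y \<in> carrier Y \<Longrightarrow> sec p y \<in> elems p" "a \<in> elems p \<Longrightarrow> prj p a \<in> carrier Y"
  using assms is_algebra homomorphisms_mem[of "prj p"] homomorphisms_mem[of "sec p"]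
  by (simp_all add: Obj_iff) blast+

lemma ObjI:
  assumes "A \<in> V" "\<phi> \<in> homomorphisms ar A Y" "\<psi> \<in> homomorphisms ar Y A"
    "\<And>y. y \<in> carrier Y \<Longrightarrow> \<phi> (\<psi> y) = y"
  shows "\<exists>p \<in> Obj C. alg p = A \<and> prj p = \<phi> \<and> sec p = \<psi>"
  by (rule bexI[of _ "((A, Y, \<phi>), (Y, A, \<psi>))"]) (use assms in \<open>simp_all add: Obj_iff alg_def prj_def sec_def\<close>)

lemma HomI:
  assumes "p \<in> Obj C" "q \<in> Obj C"
    "\<And>\<sigma> xs. length xs = ar \<sigma> \<Longrightarrow> set xs \<subseteq> elems p \<Longrightarrow>
       \<phi> (interp (alg p) \<sigma> xs) = interp (alg q) \<sigma> (map \<phi> xs)"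
    "\<And>a. a \<in> elems p \<Longrightarrow> \<phi> a \<in> elems q" "\<And>a. a \<in> elems p \<Longrightarrow> prj q (\<phi> a) = prj p a"
    "\<And>y. y \<in> carrier Y \<Longrightarrow> \<phi> (sec p y) = sec q y"
  shows "\<exists>h \<in> Hom C p q. \<forall>a \<in> elems p. fn h a = \<phi> a"
proof -
  have m: "map (restrict \<phi> (elems p)) xs = map \<phi> xs" if "set xs \<subseteq> elems p" for xs
    using that by auto
  have "interp (alg p) \<sigma> xs \<in> elems p" if "length xs = ar \<sigma>" "set xs \<subseteq> elems p" for \<sigma> xs
    using ObjD(2)[OF assms(1)] that by (auto simp: is_algebra_def)
  then have "restrict \<phi> (elems p) \<in> homomorphisms ar (alg p) (alg q)"
    using assms(3,4) by (auto simp: homomorphisms_def m)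
  then show ?thesis
    using assms ObjD(6)[OF assms(1)]
    by (intro bexI[of _ "(p, q, alg p, alg q, restrict \<phi> (elems p))"]) (simp_all add: Hom_iff fn_def)
qed

lemma Hom_eqI:
  assumes "h \<in> Hom C p q" "k \<in> Hom C p q" "\<And>a. a \<in> elems p \<Longrightarrow> fn h a = fn k a"
  shows "h = k"
proof -
  have "fn h = fn k" using homomorphism_eqI assms by (auto simp: Hom_iff)
  then show ?thesis using assms(1,2) by (auto simp: Hom_iff fn_def prod_eq_iff)
qed

lemma fn_Comp:
  assumes "h \<in> Hom C p q" "k \<in> Hom C q r" "a \<in> elems p"
  shows "fn (k \<odot>\<^bsub>C\<^esub> h) a = fn k (fn h a)"
proof -
  obtain \<phi> \<chi> where "h = (p, q, alg p, alg q, \<phi>)" "k = (q, r, alg q, alg r, \<chi>)"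
    using assms arrow_cases by metis
  then show ?thesis using assms(3) by (simp add: Pt_def Let_def alg_cat_def fn_def compose_def)
qed

lemma Comp_in_Hom:
  assumes "h \<in> Hom C p q" "k \<in> Hom C q r"
  shows "k \<odot>\<^bsub>C\<^esub> h \<in> Hom C p r"
proof -
  obtain \<phi> \<chi> where e: "h = (p, q, alg p, alg q, \<phi>)" "k = (q, r, alg q, alg r, \<chi>)"
    using assms arrow_cases by metis
  have "k \<odot>\<^bsub>C\<^esub> h = (p, r, alg p, alg r, compose (elems p) \<chi> \<phi>)"
    by (simp add: e Pt_def Let_def alg_cat_def)
  moreover have "compose (elems p) \<chi> \<phi> \<in> homomorphisms ar (alg p) (alg r)"
    using assms HomD(1)[OF assms(1)] by (intro compose_homomorphism) (auto simp: e Hom_iff fn_def ObjD)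
  moreover have "fn (k \<odot>\<^bsub>C\<^esub> h) = compose (elems p) \<chi> \<phi>" by (simp add: calculation(1) fn_def)
  moreover have "prj r (fn (k \<odot>\<^bsub>C\<^esub> h) a) = prj p a" if "a \<in> elems p" for a
    using fn_Comp[OF assms that] assms that by (simp add: HomD)
  moreover have "fn (k \<odot>\<^bsub>C\<^esub> h) (sec p y) = sec r y" if "y \<in> carrier Y" for y
    using fn_Comp[OF assms ObjD(6)[OF HomD(1)[OF assms(1)] that]] assms that by (simp add: HomD)
  ultimately show ?thesis using assms by (simp add: Hom_iff)
qed

lemma Comp_eq_iff:
  assumes "h \<in> Hom C p q" "k \<in> Hom C q r" "l \<in> Hom C p r"
  shows "k \<odot>\<^bsub>C\<^esub> h = l \<longleftrightarrow> (\<forall>a \<in> elems p. fn k (fn h a) = fn l a)"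
  using Hom_eqI[OF Comp_in_Hom[OF assms(1,2)] assms(3)] fn_Comp[OF assms(1,2)] by auto

lemma Comp_eq_Comp_iff:
  assumes "h \<in> Hom C p q" "k \<in> Hom C q r" "h' \<in> Hom C p q'" "k' \<in> Hom C q' r"
  shows "k \<odot>\<^bsub>C\<^esub> h = k' \<odot>\<^bsub>C\<^esub> h' \<longleftrightarrow> (\<forall>a \<in> elems p. fn k (fn h a) = fn k' (fn h' a))"
  using Comp_eq_iff[OF assms(1,2) Comp_in_Hom[OF assms(3,4)]] fn_Comp[OF assms(3,4)] by auto

lemma Id_in_Hom: "p \<in> Obj C \<Longrightarrow> Id C p \<in> Hom C p p"
  and fn_Id: "p \<in> Obj C \<Longrightarrow> a \<in> elems p \<Longrightarrow> fn (Id C p) a = a"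
proof -
  assume p: "p \<in> Obj C"
  have i: "Id C p = (p, p, alg p, alg p, restrict id (elems p))"
    by (simp add: Pt_def Let_def alg_def alg_cat_def Hom_def split: prod.splits)
  show "a \<in> elems p \<Longrightarrow> fn (Id C p) a = a" by (simp add: i fn_def)
  show "Id C p \<in> Hom C p p"
    using p ObjD[OF p] id_homomorphism by (auto simp: i Hom_iff fn_def)
qed

section \<open>Category laws, lifting along jointly injective families, and finite
  subproducts\<close>

lemma category: "category C"
proof
  show "f \<in> Arr C \<Longrightarrow> Dom C f \<in> Obj C" "f \<in> Arr C \<Longrightarrow> Cod C f \<in> Obj C" for f
    using Hom_ArrD[THEN HomD(1)] Hom_ArrD[THEN HomD(2)] by blast+
  show "A \<in> Obj C \<Longrightarrow> Id C A \<in> Hom C A A" for A by (rule Id_in_Hom)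
  show "f \<in> Hom C A B \<Longrightarrow> g \<in> Hom C B D \<Longrightarrow> g \<odot>\<^bsub>C\<^esub> f \<in> Hom C A D" for f g A B D
    by (rule Comp_in_Hom)
  show "f \<odot>\<^bsub>C\<^esub> Id C A = f" "Id C B \<odot>\<^bsub>C\<^esub> f = f" if "f \<in> Hom C A B" for f A B
    using that HomD[OF that] by (auto simp: Comp_eq_iff[OF Id_in_Hom _ that] Comp_eq_iff[OF _ Id_in_Hom that] fn_Id)
  show "(h \<odot>\<^bsub>C\<^esub> g) \<odot>\<^bsub>C\<^esub> f = h \<odot>\<^bsub>C\<^esub> (g \<odot>\<^bsub>C\<^esub> f)"
    if "f \<in> Hom C A B" "g \<in> Hom C B D" "h \<in> Hom C D F" for f g h A B D F
    using that HomD(8)[OF that(1)]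
    by (simp add: Comp_eq_Comp_iff[OF that(1) Comp_in_Hom[OF that(2,3)] Comp_in_Hom[OF that(1,2)] that(3)] fn_Comp)
qed

text \<open>Joint injectivity makes pointwise preimages unique, and uniqueness forces them to
  respect operations and sections, since both sides of each equation have the same images under all
  \<open>\<pi> i\<close>. At least one leg is required to read off the projection to
  \<open>Y\<close>. All universal properties below come from this.\<close>

lemma lift:
  assumes q: "q \<in> Obj C" and \<pi>: "\<And>i. i \<in> I \<Longrightarrow> \<pi> i \<in> Hom C q (p i)" and "I \<noteq> {}"
    and inj: "\<And>a b. a \<in> elems q \<Longrightarrow> b \<in> elems q \<Longrightarrow> (\<And>i. i \<in> I \<Longrightarrow> fn (\<pi> i) a = fn (\<pi> i) b) \<Longrightarrow> a = b"
    and r: "r \<in> Obj C" and h: "\<And>i. i \<in> I \<Longrightarrow> h i \<in> Hom C r (p i)"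
    and ex: "\<And>a. a \<in> elems r \<Longrightarrow> \<exists>d \<in> elems q. \<forall>i \<in> I. fn (\<pi> i) d = fn (h i) a"
  shows "\<exists>!k. k \<in> Hom C r q \<and> (\<forall>i \<in> I. \<pi> i \<odot>\<^bsub>C\<^esub> k = h i)"
proof -
  obtain i0 where i0: "i0 \<in> I" using \<open>I \<noteq> {}\<close> by auto
  obtain \<phi> where \<phi>: "\<And>a. a \<in> elems r \<Longrightarrow> \<phi> a \<in> elems q"
    "\<And>a i. a \<in> elems r \<Longrightarrow> i \<in> I \<Longrightarrow> fn (\<pi> i) (\<phi> a) = fn (h i) a"
    using ex by metis
  have "\<exists>k \<in> Hom C r q. \<forall>a \<in> elems r. fn k a = \<phi> a"
  proof (rule HomI[OF r q])
    fix \<sigma> xs assume xs: "length xs = ar \<sigma>" "set xs \<subseteq> elems r"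
    have ir: "interp (alg r) \<sigma> xs \<in> elems r" using ObjD(2)[OF r] xs by (auto simp: is_algebra_def)
    have mq: "length (map \<phi> xs) = ar \<sigma>" "set (map \<phi> xs) \<subseteq> elems q" using xs \<phi>(1) by auto
    have iq: "interp (alg q) \<sigma> (map \<phi> xs) \<in> elems q"
      using ObjD(2)[OF q] mq unfolding is_algebra_def by blast
    show "\<phi> (interp (alg r) \<sigma> xs) = interp (alg q) \<sigma> (map \<phi> xs)"
    proof (rule inj)
      fix i assume i: "i \<in> I"
      have "map (fn (\<pi> i)) (map \<phi> xs) = map (fn (h i)) xs" using \<phi>(2) i xs by auto
      then show "fn (\<pi> i) (\<phi> (interp (alg r) \<sigma> xs)) = fn (\<pi> i) (interp (alg q) \<sigma> (map \<phi> xs))"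
        using homomorphisms_app[OF HomD(7)[OF \<pi>[OF i]] mq] homomorphisms_app[OF HomD(7)[OF h[OF i]] xs]
          \<phi>(2)[OF ir i] by (simp del: map_map)
    qed (use \<phi>(1) ir iq in auto)
  next
    fix a assume a: "a \<in> elems r"
    show "prj q (\<phi> a) = prj r a"
      using HomD(9)[OF \<pi>[OF i0] \<phi>(1)[OF a]] HomD(9)[OF h[OF i0] a] \<phi>(2)[OF a i0] by simp
  next
    fix y assume y: "y \<in> carrier Y"
    then have "sec r y \<in> elems r" "sec q y \<in> elems q" using ObjD(6) r q by auto
    then show "\<phi> (sec r y) = sec q y"
      using \<phi> HomD(10)[OF h y] HomD(10)[OF \<pi> y] by (subst inj[of _ "sec q y"]) auto
  qed (use \<phi> in auto)
  then obtain k where k: "k \<in> Hom C r q" "\<And>a. a \<in> elems r \<Longrightarrow> fn k a = \<phi> a" by blast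
  have "k \<in> Hom C r q \<and> (\<forall>i \<in> I. \<pi> i \<odot>\<^bsub>C\<^esub> k = h i)"
    using k \<phi>(2) by (auto simp: Comp_eq_iff[OF k(1) \<pi> h])
  moreover have "l = k" if l: "l \<in> Hom C r q" "\<forall>i \<in> I. \<pi> i \<odot>\<^bsub>C\<^esub> l = h i" for l
  proof (rule Hom_eqI[OF l(1) k(1)])
    fix a assume a: "a \<in> elems r"
    show "fn l a = fn k a"
      using l(2) k(2)[OF a] \<phi>(2)[OF a] \<phi>(1)[OF a] HomD(8)[OF l(1) a] a
      by (subst inj[of _ "fn k a"]) (auto simp: Comp_eq_iff[OF l(1) \<pi> h])
  qed
  ultimately show ?thesis by blast
qed

text \<open>A set of tuples forms a point over \<open>Y\<close> when it is closed under the
  operations, contains the tuples of section values, and each of its tuples lies over a single point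
  of \<open>Y\<close>.\<close>

lemma subproduct_point:
  fixes p :: "nat \<Rightarrow> ('f, 'u) point"
  assumes p: "\<And>i. i < n \<Longrightarrow> p i \<in> Obj C" and "0 < n"
    and B: "B \<subseteq> (\<Pi>\<^sub>E i\<in>{..<n}. elems (p i))"
    and prj: "\<And>b i. b \<in> B \<Longrightarrow> i < n \<Longrightarrow> prj (p i) (b i) = prj (p 0) (b 0)"
    and cl: "\<And>\<sigma> bs. length bs = ar \<sigma> \<Longrightarrow> set bs \<subseteq> B \<Longrightarrow>
               (\<lambda>i\<in>{..<n}. interp (alg (p i)) \<sigma> (map (\<lambda>b. b i) bs)) \<in> B"
    and sec: "\<And>y. y \<in> carrier Y \<Longrightarrow> (\<lambda>i\<in>{..<n}. sec (p i) y) \<in> B"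
  shows "\<exists>q \<pi>. q \<in> Obj C \<and> (\<forall>i<n. \<pi> i \<in> Hom C q (p i)) \<and>
    (\<forall>a \<in> elems q. \<forall>b \<in> elems q. (\<forall>i<n. fn (\<pi> i) a = fn (\<pi> i) b) \<longrightarrow> a = b) \<and>
    (\<forall>a \<in> elems q. (\<lambda>i\<in>{..<n}. fn (\<pi> i) a) \<in> B) \<and>
    (\<forall>b \<in> B. \<exists>a \<in> elems q. \<forall>i<n. fn (\<pi> i) a = b i)"
proof -
  obtain l :: "'u list \<Rightarrow> 'u" where l: "inj l" using list_inj_exists[OF inf] .
  \<comment> \<open>Tuples are extensional on the first \<open>n\<close> indices, so the list of
    their \<open>n\<close> values determines them.\<close>
  define j where "j b = l (map b [0..<n])" for b
  have j: "inj_on j B"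
  proof (rule inj_onI)
    fix b c assume bc: "b \<in> B" "c \<in> B" "j b = j c"
    then have "\<forall>i<n. b i = c i" using l by (auto simp: j_def inj_eq list_eq_iff_nth_eq)
    then show "b = c" using bc B by (intro PiE_ext[of b "{..<n}" "\<lambda>i. elems (p i)" c]) auto
  qed
  obtain A e where A: "A \<in> V" and e: "\<And>i. i \<in> {..<n} \<Longrightarrow> e i \<in> homomorphisms ar A (alg (p i))"
    and sep: "\<And>a b. a \<in> carrier A \<Longrightarrow> b \<in> carrier A \<Longrightarrow> (\<And>i. i \<in> {..<n} \<Longrightarrow> e i a = e i b) \<Longrightarrow> a = b"
    and eB: "\<And>a. a \<in> carrier A \<Longrightarrow> (\<lambda>i\<in>{..<n}. e i a) \<in> B"
    and Be: "\<And>b. b \<in> B \<Longrightarrow> \<exists>a \<in> carrier A. \<forall>i\<in>{..<n}. e i a = b i"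
    by (rule subproduct_exists[OF V wfE _ B cl j]) (use p ObjD in auto)
  have alg: "is_algebra ar A" using A V by auto
  \<comment> \<open>Every coordinate yields the same projection by \<open>prj\<close>; coordinate 0
    is available because \<open>n\<close> is positive.\<close>
  define \<phi> where "\<phi> = compose (carrier A) (prj (p 0)) (e 0)"
  have \<phi>h: "\<phi> \<in> homomorphisms ar A Y"
    unfolding \<phi>_def using A e[of 0] \<open>0 < n\<close> ObjD(3)[OF p] by (auto intro: compose_homomorphism)
  have e\<phi>: "prj (p i) (e i a) = \<phi> a" if "a \<in> carrier A" "i < n" for i a
    using prj[OF eB[OF that(1)] that(2)] that \<open>0 < n\<close> by (simp add: \<phi>_def compose_def)
  have "\<forall>y \<in> carrier Y. \<exists>a. a \<in> carrier A \<and> (\<forall>i<n. e i a = sec (p i) y)"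
    using Be[OF sec] by fastforce
  from bchoice[OF this] obtain \<psi> where \<psi>: "\<And>y. y \<in> carrier Y \<Longrightarrow> \<psi> y \<in> carrier A"
    "\<And>y i. y \<in> carrier Y \<Longrightarrow> i < n \<Longrightarrow> e i (\<psi> y) = sec (p i) y"
    by blast
  have "restrict \<psi> (carrier Y) \<in> homomorphisms ar Y A"
    unfolding homomorphisms_def
  proof (intro CollectI conjI allI impI)
    fix \<sigma> xs assume xs: "length xs = ar \<sigma> \<and> set xs \<subseteq> carrier Y"
    have iY: "interp Y \<sigma> xs \<in> carrier Y" using Y V xs by (auto simp: is_algebra_def)
    have m: "map (restrict \<psi> (carrier Y)) xs = map \<psi> xs" using xs by auto
    have mA: "length (map \<psi> xs) = ar \<sigma>" "set (map \<psi> xs) \<subseteq> carrier A" using xs \<psi>(1) by auto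
    have "\<psi> (interp Y \<sigma> xs) = interp A \<sigma> (map \<psi> xs)"
    proof (rule sep)
      show "interp A \<sigma> (map \<psi> xs) \<in> carrier A" using alg mA unfolding is_algebra_def by blast
      fix i assume i: "i \<in> {..<n}"
      have "map (e i) (map \<psi> xs) = map (sec (p i)) xs" using xs \<psi>(2) i by auto
      then show "e i (\<psi> (interp Y \<sigma> xs)) = e i (interp A \<sigma> (map \<psi> xs))"
        using homomorphisms_app[OF e[OF i] mA] homomorphisms_app[OF ObjD(4)[OF p], of i xs \<sigma>] xs i
          \<psi>(2)[OF iY] by (simp del: map_map)
    qed (use \<psi> iY in auto)
    then show "restrict \<psi> (carrier Y) (interp Y \<sigma> xs) = interp A \<sigma> (map (restrict \<psi> (carrier Y)) xs)"
      unfolding m using iY by simp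
  qed (use \<psi> in auto)
  moreover have "\<phi> (\<psi> y) = y" if "y \<in> carrier Y" for y
    using e\<phi>[OF \<psi>(1)[OF that] \<open>0 < n\<close>] \<psi>(2)[OF that \<open>0 < n\<close>] ObjD(5)[OF p[OF \<open>0 < n\<close>] that] by simp
  ultimately obtain q where q: "q \<in> Obj C" "alg q = A" "prj q = \<phi>" "sec q = restrict \<psi> (carrier Y)"
    using ObjI[OF A \<phi>h, of "restrict \<psi> (carrier Y)"] by (metis (no_types, lifting) restrict_apply')
  have "\<exists>h \<in> Hom C q (p i). \<forall>a \<in> elems q. fn h a = e i a" if i: "i < n" for i
  proof (rule HomI[OF q(1) p[OF i], of "e i"])
    have ei: "e i \<in> homomorphisms ar A (alg (p i))" using e i by simp
    show "e i (interp (alg q) \<sigma> xs) = interp (alg (p i)) \<sigma> (map (e i) xs)"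
      if "length xs = ar \<sigma>" "set xs \<subseteq> elems q" for \<sigma> xs
      using homomorphisms_app[OF ei] that q(2) by simp
    show "e i a \<in> elems (p i)" if "a \<in> elems q" for a
      using homomorphisms_mem[OF ei] that q(2) by simp
  qed (use i q(2-4) e\<phi> \<psi> in auto)
  then obtain \<pi> where \<pi>: "\<And>i. i < n \<Longrightarrow> \<pi> i \<in> Hom C q (p i)"
    "\<And>i a. i < n \<Longrightarrow> a \<in> elems q \<Longrightarrow> fn (\<pi> i) a = e i a"
    by metis
  have "(\<lambda>i\<in>{..<n}. fn (\<pi> i) a) = (\<lambda>i\<in>{..<n}. e i a)" if "a \<in> elems q" for a
    using \<pi>(2) that by auto
  moreover have "\<exists>a \<in> elems q. \<forall>i<n. fn (\<pi> i) a = b i" if "b \<in> B" for b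
    using Be[OF that] q(2) \<pi>(2) by force
  ultimately show ?thesis
    using sep eB q(1,2) \<pi> by (intro exI[of _ q] exI[of _ \<pi>]) auto
qed

section \<open>Limits, monomorphisms and extremal epimorphisms in the fibre\<close>

lemma all_less4: "(\<forall>i<4. Q i) \<longleftrightarrow> Q 0 \<and> Q 1 \<and> Q 2 \<and> Q (3::nat)"
  by (auto simp: numeral_eq_Suc less_Suc_eq)

lemma all_less3: "(\<forall>i<3. Q i) \<longleftrightarrow> Q 0 \<and> Q 1 \<and> Q (2::nat)"
  by (auto simp: numeral_eq_Suc less_Suc_eq)

lemma all_less2: "(\<forall>i<2. Q i) \<longleftrightarrow> Q 0 \<and> Q (1::nat)"
  by (auto simp: numeral_eq_Suc less_Suc_eq)

lemma subproduct2:
  assumes A: "A \<in> Obj C" and B: "B \<in> Obj C" and S: "S \<subseteq> elems A \<times> elems B"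
    and pr: "\<And>a b. (a, b) \<in> S \<Longrightarrow> prj A a = prj B b"
    and c: "compatible ar (alg A) (alg B) S"
    and se: "\<And>y. y \<in> carrier Y \<Longrightarrow> (sec A y, sec B y) \<in> S"
  obtains q u v where "u \<in> Hom C q A" "v \<in> Hom C q B"
    "\<And>d e. d \<in> elems q \<Longrightarrow> e \<in> elems q \<Longrightarrow> fn u d = fn u e \<Longrightarrow> fn v d = fn v e \<Longrightarrow> d = e"
    "\<And>d. d \<in> elems q \<Longrightarrow> (fn u d, fn v d) \<in> S"
    "\<And>a b. (a, b) \<in> S \<Longrightarrow> \<exists>d \<in> elems q. fn u d = a \<and> fn v d = b"
proof -
  define p where "p i = (if i = 0 then A else B)" for i :: nat
  define S' where "S' = {b \<in> (\<Pi>\<^sub>E i\<in>{..<2}. elems (p i)). (b 0, b 1) \<in> S}"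
  have cl: "(\<lambda>i\<in>{..<2}. interp (alg (p i)) \<sigma> (map (\<lambda>b. b i) bs)) \<in> S'"
    if "length bs = ar \<sigma>" "set bs \<subseteq> S'" for \<sigma> bs
  proof -
    have "(interp (alg A) \<sigma> (map (\<lambda>b. b 0) bs), interp (alg B) \<sigma> (map (\<lambda>b. b 1) bs)) \<in> S"
      by (rule compatibleD[OF c that(1)]) (use that(2) in \<open>auto simp: S'_def\<close>)
    then show ?thesis using S by (auto simp: S'_def p_def less_2_cases_iff)
  qed
  have se': "(\<lambda>i\<in>{..<2}. sec (p i) y) \<in> S'" if "y \<in> carrier Y" for y
    using se[OF that] S by (auto simp: S'_def p_def less_2_cases_iff)
  have pr': "prj (p i) (b i) = prj (p 0) (b 0)" if "b \<in> S'" "i < 2" for b i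
    using that pr by (auto simp: S'_def p_def less_2_cases_iff)
  have p: "p i \<in> Obj C" if "i < 2" for i using A B by (simp add: p_def)
  have sub: "S' \<subseteq> (\<Pi>\<^sub>E i\<in>{..<2}. elems (p i))" by (auto simp: S'_def)
  show thesis
  proof (rule exE[OF subproduct_point[OF p zero_less_numeral sub pr' cl se']], assumption+, elim exE conjE)
    fix q \<pi>
    assume \<pi>: "\<forall>i<2. \<pi> i \<in> Hom C q (p i)"
      and inj: "\<forall>a \<in> elems q. \<forall>b \<in> elems q. (\<forall>i<2. fn (\<pi> i) a = fn (\<pi> i) b) \<longrightarrow> a = b"
      and mem: "\<forall>a \<in> elems q. (\<lambda>i\<in>{..<2}. fn (\<pi> i) a) \<in> S'"
      and onto: "\<forall>b \<in> S'. \<exists>a \<in> elems q. \<forall>i<2. fn (\<pi> i) a = b i"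
    show thesis
    proof (rule that[of "\<pi> 0" q "\<pi> 1"])
      show "\<pi> 0 \<in> Hom C q A" "\<pi> 1 \<in> Hom C q B" using \<pi> by (simp_all add: all_less2 p_def)
      show "d = e" if "d \<in> elems q" "e \<in> elems q" "fn (\<pi> 0) d = fn (\<pi> 0) e" "fn (\<pi> 1) d = fn (\<pi> 1) e" for d e
        using inj that unfolding all_less2 by blast
      show "(fn (\<pi> 0) d, fn (\<pi> 1) d) \<in> S" if "d \<in> elems q" for d
        using mem that by (auto simp: S'_def)
      show "\<exists>d \<in> elems q. fn (\<pi> 0) d = a \<and> fn (\<pi> 1) d = b" if "(a, b) \<in> S" for a b
      proof -
        have "(\<lambda>i\<in>{..<2}. if i = 0 then a else b) \<in> S'"
          using that S by (auto simp: S'_def p_def less_2_cases_iff)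
        from bspec[OF onto this] show ?thesis by (simp add: all_less2)
      qed
    qed
  qed
qed

lemma lift2:
  assumes u: "u \<in> Hom C q A" and v: "v \<in> Hom C q B"
    and inj: "\<And>d e. d \<in> elems q \<Longrightarrow> e \<in> elems q \<Longrightarrow> fn u d = fn u e \<Longrightarrow> fn v d = fn v e \<Longrightarrow> d = e"
    and a: "a \<in> Hom C D A" and b: "b \<in> Hom C D B"
    and ex: "\<And>d. d \<in> elems D \<Longrightarrow> \<exists>c \<in> elems q. fn u c = fn a d \<and> fn v c = fn b d"
  shows "\<exists>!h. h \<in> Hom C D q \<and> u \<odot>\<^bsub>C\<^esub> h = a \<and> v \<odot>\<^bsub>C\<^esub> h = b"
proof -
  have "\<exists>!h. h \<in> Hom C D q \<and> (\<forall>i\<in>{0, 1}. [u, v] ! i \<odot>\<^bsub>C\<^esub> h = [a, b] ! i)"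
  proof (rule lift[where I = "{0, 1}" and \<pi> = "\<lambda>i. [u, v] ! i" and p = "\<lambda>i. [A, B] ! i" and h = "\<lambda>i. [a, b] ! i"])
    show "d = e" if "d \<in> elems q" "e \<in> elems q" "\<And>i. i \<in> {0, 1} \<Longrightarrow> fn ([u, v] ! i) d = fn ([u, v] ! i) e" for d e
      using that(3)[of 0] that(3)[of 1] by (intro inj[OF that(1,2)]) simp_all
    show "\<exists>c \<in> elems q. \<forall>i\<in>{0, 1}. fn ([u, v] ! i) c = fn ([a, b] ! i) d" if "d \<in> elems D" for d
      using ex[OF that] by simp
  qed (use u v a b HomD(1) in auto)
  then show ?thesis by simp
qed

lemma ex_pullback:
  assumes f: "f \<in> Hom C A X" and g: "g \<in> Hom C B X"
  obtains p q where "is_pullback C f g p q"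
proof -
  note A = HomD(1)[OF f] and B = HomD(1)[OF g]
  \<comment> \<open>The one-element index set brings the single equation into the form of
    \<open>compatible_equalizer\<close>.\<close>
  define S where "S = {(a, b) \<in> elems A \<times> elems B. \<forall>i\<in>{()}. fn f a = fn g b}"
  have c: "compatible ar (alg A) (alg B) S"
    unfolding S_def
    by (rule compatible_equalizer[OF ObjD(2)[OF A] ObjD(2)[OF B] HomD(7)[OF f] HomD(7)[OF g]])
  have pr: "prj A a = prj B b" if "(a, b) \<in> S" for a b
    using that HomD(9)[OF f, of a] HomD(9)[OF g, of b] by (auto simp: S_def)
  have se: "(sec A y, sec B y) \<in> S" if "y \<in> carrier Y" for y
    using that HomD(10)[OF f] HomD(10)[OF g] ObjD(6)[OF A] ObjD(6)[OF B] by (auto simp: S_def)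
  have sub: "S \<subseteq> elems A \<times> elems B" by (auto simp: S_def)
  obtain q u v where u: "u \<in> Hom C q A" and v: "v \<in> Hom C q B"
    and inj: "\<And>d e. d \<in> elems q \<Longrightarrow> e \<in> elems q \<Longrightarrow> fn u d = fn u e \<Longrightarrow> fn v d = fn v e \<Longrightarrow> d = e"
    and mem: "\<And>d. d \<in> elems q \<Longrightarrow> (fn u d, fn v d) \<in> S"
    and onto: "\<And>a b. (a, b) \<in> S \<Longrightarrow> \<exists>d \<in> elems q. fn u d = a \<and> fn v d = b"
    by (rule subproduct2[OF A B sub pr c se]) (assumption | (rule that; assumption))+
  have "\<exists>!h. h \<in> Hom C D q \<and> u \<odot>\<^bsub>C\<^esub> h = a \<and> v \<odot>\<^bsub>C\<^esub> h = b"
    if D: "D \<in> Obj C" "a \<in> Hom C D A" "b \<in> Hom C D B" "f \<odot>\<^bsub>C\<^esub> a = g \<odot>\<^bsub>C\<^esub> b" for D a b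
  proof -
    have "\<forall>d \<in> elems D. fn f (fn a d) = fn g (fn b d)"
      using D(4) by (simp add: Comp_eq_Comp_iff[OF D(2) f D(3) g])
    then have ex: "\<exists>c \<in> elems q. fn u c = fn a d \<and> fn v c = fn b d" if "d \<in> elems D" for d
      using that HomD(8)[OF D(2)] HomD(8)[OF D(3)] by (intro onto) (auto simp: S_def)
    show ?thesis by (rule lift2[OF u v inj D(2,3) ex])
  qed
  moreover have "f \<odot>\<^bsub>C\<^esub> u = g \<odot>\<^bsub>C\<^esub> v"
    using mem by (simp add: Comp_eq_Comp_iff[OF u f v g] S_def)
  ultimately have "is_pullback C f g u v"
    using HomD(3-5)[OF u] HomD(4)[OF f] HomD(4)[OF g] v by (simp add: is_pullback_def)
  then show thesis using that by blast
qed

section \<open>The zero object of the fibre and zero arrows\<close>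

lemma base_point:
  obtains N where "N \<in> Obj C" "alg N = Y" "prj N = restrict id (carrier Y)" "sec N = restrict id (carrier Y)"
proof -
  have "\<exists>p \<in> Obj C. alg p = Y \<and> prj p = restrict id (carrier Y) \<and> sec p = restrict id (carrier Y)"
    by (rule ObjI[OF Y id_homomorphism[OF Y] id_homomorphism[OF Y]]) simp
  then show thesis using that by blast
qed

text \<open>Compatibility with the projections leaves \<open>prj A\<close> as the only arrow into
  the identity point of \<open>Y\<close>, and compatibility with the sections leaves
  \<open>sec A\<close> as the only arrow out of it.\<close>

lemma zero_base_point:
  assumes N: "N \<in> Obj C" "alg N = Y" "prj N = restrict id (carrier Y)" "sec N = restrict id (carrier Y)"
  shows "zero_obj C N"
proof -
  have "\<exists>!h. h \<in> Hom C A N" if A: "A \<in> Obj C" for A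
  proof (rule ex_ex1I)
    have "\<exists>h \<in> Hom C A N. \<forall>a \<in> elems A. fn h a = prj A a"
      by (rule HomI[OF A N(1)]) (use ObjD[OF A] homomorphisms_app[OF ObjD(3)[OF A]] N in auto)
    then show "\<exists>h. h \<in> Hom C A N" by blast
    show "h = k" if "h \<in> Hom C A N" "k \<in> Hom C A N" for h k
    proof (rule Hom_eqI[OF that])
      fix a assume a: "a \<in> elems A"
      show "fn h a = fn k a"
        using HomD(8,9)[OF that(1) a] HomD(8,9)[OF that(2) a] N by simp
    qed
  qed
  moreover have "\<exists>!h. h \<in> Hom C N A" if A: "A \<in> Obj C" for A
  proof (rule ex_ex1I)
    have "\<exists>h \<in> Hom C N A. \<forall>a \<in> elems N. fn h a = sec A a"
      by (rule HomI[OF N(1) A]) (use ObjD[OF A] homomorphisms_app[OF ObjD(4)[OF A]] N in auto)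
    then show "\<exists>h. h \<in> Hom C N A" by blast
    show "h = k" if "h \<in> Hom C N A" "k \<in> Hom C N A" for h k
    proof (rule Hom_eqI[OF that])
      fix a assume "a \<in> elems N"
      then show "fn h a = fn k a"
        using HomD(10)[OF that(1), of a] HomD(10)[OF that(2), of a] N by simp
    qed
  qed
  ultimately show ?thesis using N by (simp add: zero_obj_def terminal_obj_def initial_obj_def)
qed

lemma fibre_pointed_finitely_complete: "pointed_finitely_complete_category C"
proof -
  obtain N where "zero_obj C N" using base_point zero_base_point by metis
  moreover have "\<exists>p q. is_pullback C f g p q" if "f \<in> Arr C" "g \<in> Arr C" "Cod C f = Cod C g" for f g
    using ex_pullback[OF Hom_ArrD[OF that(1)]] Hom_ArrD[OF that(2)] that(3) by metis
  ultimately show ?thesis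
    using category unfolding pointed_finitely_complete_category_def finitely_complete_category_def
      finitely_complete_category_axioms_def pointed_finitely_complete_category_axioms_def zero_obj_def
    by blast
qed

text \<open>The zero object in the factorisation is arbitrary. Passing from it to the identity point
  and back is its identity, so each of its elements is a section value, and arrows preserve section
  values.\<close>

lemma zero_arr_fn:
  assumes h: "zero_arr C h" "h \<in> Hom C A B" and a: "a \<in> elems A"
  shows "fn h a = sec B (prj A a)"
proof -
  obtain Z u v where Z: "zero_obj C Z" and u: "u \<in> Hom C A Z" and v: "v \<in> Hom C Z B" and huv: "h = v \<odot>\<^bsub>C\<^esub> u"
    using h(1) HomD(4,5)[OF h(2)] by (auto simp: zero_arr_def)
  obtain N where N: "N \<in> Obj C" "alg N = Y" "prj N = restrict id (carrier Y)" "sec N = restrict id (carrier Y)"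
    using base_point .
  have ZO: "Z \<in> Obj C" using HomD(1)[OF v] .
  obtain s where s: "s \<in> Hom C Z N" using zero_base_point[OF N] ZO by (auto simp: zero_obj_def terminal_obj_def)
  obtain r where r: "r \<in> Hom C N Z" using Z N(1) by (auto simp: zero_obj_def terminal_obj_def)
  have "\<exists>!k. k \<in> Hom C Z Z" using Z ZO by (auto simp: zero_obj_def terminal_obj_def)
  then have "r \<odot>\<^bsub>C\<^esub> s = Id C Z" using Comp_in_Hom[OF s r] Id_in_Hom[OF ZO] by auto
  then have rs: "fn r (fn s z) = z" if "z \<in> elems Z" for z
    using fn_Comp[OF s r that] fn_Id[OF ZO that] by simp
  have z: "z = sec Z (prj Z z)" if "z \<in> elems Z" for z
  proof -
    have "fn s z = prj Z z" using HomD(8,9)[OF s that] N by simp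
    then show ?thesis using rs[OF that] HomD(10)[OF r, of "prj Z z"] ObjD(7)[OF ZO that] N by simp
  qed
  have "fn h a = fn v (fn u a)" using fn_Comp[OF u v a] huv by simp
  also have "\<dots> = fn v (sec Z (prj Z (fn u a)))" using z HomD(8)[OF u a] by metis
  also have "\<dots> = sec B (prj A a)"
    using HomD(9)[OF u a] HomD(10)[OF v] ObjD(7)[OF HomD(1)[OF u] a] by simp
  finally show ?thesis .
qed

text \<open>The test object is the joint kernel pair of the family: its two projections are
  equalised by every \<open>\<pi> i\<close>, hence equal, and the pair (a, b) is their value at some
  element.\<close>

lemma jointly_monic_imp_injective:
  assumes "I \<noteq> {}" and \<pi>: "\<And>i. i \<in> I \<Longrightarrow> \<pi> i \<in> Hom C q (p i)"
    and mono: "\<And>A h k. A \<in> Obj C \<Longrightarrow> h \<in> Hom C A q \<Longrightarrow> k \<in> Hom C A q \<Longrightarrow>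
                 (\<And>i. i \<in> I \<Longrightarrow> \<pi> i \<odot>\<^bsub>C\<^esub> h = \<pi> i \<odot>\<^bsub>C\<^esub> k) \<Longrightarrow> h = k"
    and ab: "a \<in> elems q" "b \<in> elems q" "\<And>i. i \<in> I \<Longrightarrow> fn (\<pi> i) a = fn (\<pi> i) b"
  shows "a = b"
proof -
  obtain i0 where i0: "i0 \<in> I" using \<open>I \<noteq> {}\<close> by auto
  have q: "q \<in> Obj C" using HomD(1)[OF \<pi>[OF i0]] .
  define S where "S = {(a, b) \<in> elems q \<times> elems q. \<forall>i\<in>I. fn (\<pi> i) a = fn (\<pi> i) b}"
  have c: "compatible ar (alg q) (alg q) S"
    unfolding S_def
    by (rule compatible_equalizer[OF ObjD(2)[OF q] ObjD(2)[OF q] HomD(7)[OF \<pi>] HomD(7)[OF \<pi>]])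
  have pr: "prj q a = prj q b" if "(a, b) \<in> S" for a b
    using that HomD(9)[OF \<pi>[OF i0], of a] HomD(9)[OF \<pi>[OF i0], of b] i0 by (auto simp: S_def)
  have se: "(sec q y, sec q y) \<in> S" if "y \<in> carrier Y" for y
    using ObjD(6)[OF q that] by (auto simp: S_def)
  have sub: "S \<subseteq> elems q \<times> elems q" by (auto simp: S_def)
  obtain D u v where u: "u \<in> Hom C D q" and v: "v \<in> Hom C D q"
    and mem: "\<And>d. d \<in> elems D \<Longrightarrow> (fn u d, fn v d) \<in> S"
    and onto: "\<And>a b. (a, b) \<in> S \<Longrightarrow> \<exists>d \<in> elems D. fn u d = a \<and> fn v d = b"
    by (rule subproduct2[OF q q sub pr c se]) (assumption | (rule that; assumption))+
  have "u = v"
    by (rule mono[OF HomD(1)[OF u] u v]) (use mem in \<open>simp add: Comp_eq_Comp_iff[OF u \<pi> v \<pi>] S_def\<close>)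
  then show ?thesis using onto[of a b] ab by (auto simp: S_def)
qed

section \<open>Monomorphisms, isomorphisms and extremal epimorphisms on elements\<close>

lemma is_relation_iff:
  "is_relation C W X Z f g \<longleftrightarrow> f \<in> Hom C W X \<and> g \<in> Hom C W Z \<and>
     (\<forall>a \<in> elems W. \<forall>b \<in> elems W. fn f a = fn f b \<and> fn g a = fn g b \<longrightarrow> a = b)" (is "?L \<longleftrightarrow> ?R")
proof
  assume L: ?L
  then have f: "f \<in> Hom C W X" and g: "g \<in> Hom C W Z" by (auto simp: is_relation_def)
  have "a = b" if "a \<in> elems W" "b \<in> elems W" "fn f a = fn f b" "fn g a = fn g b" for a b
  proof (rule jointly_monic_imp_injective[where I = "{0, 1}" and \<pi> = "\<lambda>i. [f, g] ! i" and p = "\<lambda>i. [X, Z] ! i"])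
    show "h = k" if "A \<in> Obj C" "h \<in> Hom C A W" "k \<in> Hom C A W"
      "\<And>i. i \<in> {0, 1} \<Longrightarrow> [f, g] ! i \<odot>\<^bsub>C\<^esub> h = [f, g] ! i \<odot>\<^bsub>C\<^esub> k" for A h k
      using L that(1-3) that(4)[of 0] that(4)[of 1] by (simp add: is_relation_def)
  qed (use f g that in auto)
  then show ?R using f g by blast
next
  assume R: ?R
  then have f: "f \<in> Hom C W X" and g: "g \<in> Hom C W Z" by auto
  have "h = k" if "h \<in> Hom C A W" "k \<in> Hom C A W" "f \<odot>\<^bsub>C\<^esub> h = f \<odot>\<^bsub>C\<^esub> k" "g \<odot>\<^bsub>C\<^esub> h = g \<odot>\<^bsub>C\<^esub> k" for A h k
  proof (rule Hom_eqI[OF that(1,2)])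
    fix a assume "a \<in> elems A"
    then show "fn h a = fn k a"
      using that R HomD(8)[OF that(1)] HomD(8)[OF that(2)]
      by (simp add: Comp_eq_Comp_iff[OF that(1) f that(2) f] Comp_eq_Comp_iff[OF that(1) g that(2) g])
  qed
  then show ?L using f g by (auto simp: is_relation_def)
qed

lemma mono_arr_injective:
  assumes "mono_arr C m" "m \<in> Hom C B A" "a \<in> elems B" "b \<in> elems B" "fn m a = fn m b"
  shows "a = b"
proof -
  have "is_relation C B A A m m"
    using assms(1,2) HomD(4)[OF assms(2)] by (auto simp: is_relation_def mono_arr_def)
  then show ?thesis using assms(3-) by (auto simp: is_relation_iff)
qed

lemma bijective_iso:
  assumes m: "m \<in> Hom C B A" and bij: "bij_betw (fn m) (elems B) (elems A)"
  shows "iso_arr C m"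
proof -
  note B = HomD(1)[OF m] and A = HomD(2)[OF m]
  have "\<exists>!k. k \<in> Hom C A B \<and> (\<forall>i\<in>{()}. m \<odot>\<^bsub>C\<^esub> k = Id C A)"
  proof (rule lift[OF B, where p = "\<lambda>_. A"])
    show "\<exists>d \<in> elems B. \<forall>i\<in>{()}. fn m d = fn (Id C A) a" if "a \<in> elems A" for a
    proof -
      have "a \<in> fn m ` elems B" using bij that by (simp add: bij_betw_def)
      then show ?thesis by (simp add: fn_Id[OF A that] image_iff) metis
    qed
  qed (use m A bij Id_in_Hom in \<open>auto simp: bij_betw_def inj_on_def\<close>)
  then obtain k where k: "k \<in> Hom C A B" "m \<odot>\<^bsub>C\<^esub> k = Id C A" by blast
  then have mk: "fn m (fn k a) = a" if "a \<in> elems A" for a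
    using fn_Comp[OF k(1) m that] fn_Id[OF A that] k(2) by simp
  have "k \<odot>\<^bsub>C\<^esub> m = Id C B"
  proof (subst Comp_eq_iff[OF m k(1) Id_in_Hom[OF B]], intro ballI)
    fix b assume b: "b \<in> elems B"
    have "fn m (fn k (fn m b)) = fn m b" using mk HomD(8)[OF m b] by simp
    then show "fn k (fn m b) = fn (Id C B) b"
      using bij b HomD(8)[OF k(1) HomD(8)[OF m b]] fn_Id[OF B b] by (auto simp: bij_betw_def dest: inj_onD)
  qed
  then show ?thesis using k HomD(3-5)[OF m] by (auto simp: iso_arr_def)
qed

text \<open>If e = m g is onto, so is m. A monomorphism m is moreover injective, and a bijective
  arrow is invertible in the fibre.\<close>

lemma surjective_extremal_epi:
  assumes e: "e \<in> Hom C P Q" and surj: "\<And>q. q \<in> elems Q \<Longrightarrow> \<exists>p \<in> elems P. fn e p = q"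
  shows "extremal_epi C e"
proof -
  have "h = k" if "h \<in> Hom C Q B" "k \<in> Hom C Q B" "h \<odot>\<^bsub>C\<^esub> e = k \<odot>\<^bsub>C\<^esub> e" for B h k
  proof (rule Hom_eqI[OF that(1,2)])
    fix a assume "a \<in> elems Q"
    then show "fn h a = fn k a"
      using surj that(3) by (auto simp: Comp_eq_Comp_iff[OF e that(1) e that(2)])
  qed
  then have "epi_arr C e" using HomD(3,5)[OF e] by (auto simp: epi_arr_def)
  moreover have "iso_arr C m"
    if g: "g \<in> Hom C P B" and m: "m \<in> Hom C B Q" "mono_arr C m" "e = m \<odot>\<^bsub>C\<^esub> g" for B g m
  proof (rule bijective_iso[OF m(1)])
    have "q \<in> fn m ` elems B" if "q \<in> elems Q" for q
      using surj[OF that] fn_Comp[OF g m(1)] HomD(8)[OF g] m(3) by (metis imageI)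
    then show "bij_betw (fn m) (elems B) (elems Q)"
      using mono_arr_injective[OF m(2,1)] HomD(8)[OF m(1)] by (auto simp: bij_betw_def inj_on_def)
  qed
  ultimately show ?thesis using HomD(4,5)[OF e] by (auto simp: extremal_epi_def)
qed

lemma iso_surjective:
  assumes "iso_arr C e" and e: "e \<in> Hom C P Q" and q: "q \<in> elems Q"
  shows "\<exists>p \<in> elems P. fn e p = q"
proof -
  obtain k where k: "k \<in> Hom C Q P" "e \<odot>\<^bsub>C\<^esub> k = Id C Q"
    using assms(1) HomD(4,5)[OF e] by (auto simp: iso_arr_def)
  then show ?thesis
    using fn_Comp[OF k(1) e q] fn_Id[OF HomD(2)[OF e] q] HomD(8)[OF k(1) q] k(2) by metis
qed

section \<open>Internal relations in the fibre\<close>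

lemma graph_eq: "fst R \<in> Hom C D W \<Longrightarrow> graph R = (\<lambda>d. (fn (fst R) d, fn (snd R) d)) ` elems D"
  by (simp add: graph_def HomD(6))

lemma graph_subset: "fst R \<in> Hom C D A \<Longrightarrow> snd R \<in> Hom C D B \<Longrightarrow> graph R \<subseteq> elems A \<times> elems B"
  using HomD(8)[of "fst R" D A] HomD(8)[of "snd R" D B] by (auto simp: graph_eq)

lemma graphE:
  assumes "(a, b) \<in> graph R" "fst R \<in> Hom C D A"
  shows "\<exists>d \<in> elems D. fn (fst R) d = a \<and> fn (snd R) d = b"
  using assms unfolding graph_eq[OF assms(2)] by blast

lemma graph_prj:
  assumes "fst R \<in> Hom C D A" "snd R \<in> Hom C D B" "(a, b) \<in> graph R"
  shows "prj A a = prj B b"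
  using assms HomD(9)[OF assms(1)] HomD(9)[OF assms(2)] by (auto simp: graph_eq)

lemma graph_sec:
  assumes "fst R \<in> Hom C D A" "snd R \<in> Hom C D B" "y \<in> carrier Y"
  shows "(sec A y, sec B y) \<in> graph R"
  using HomD(10)[OF assms(1,3)] HomD(10)[OF assms(2,3)] ObjD(6)[OF HomD(1)[OF assms(1)] assms(3)]
  unfolding graph_eq[OF assms(1)] by (intro image_eqI[of _ _ "sec D y"]) simp_all

lemma graph_compatible:
  assumes r: "fst R \<in> Hom C D A" and r': "snd R \<in> Hom C D B"
  shows "compatible ar (alg A) (alg B) (graph R)"
  unfolding compatible_def
proof (intro allI impI, elim conjE)
  fix \<sigma> xs ys
  assume len: "length xs = ar \<sigma>" and l: "list_all2 (\<lambda>x y. (x, y) \<in> graph R) xs ys"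
  have "\<forall>i<length xs. \<exists>d. d \<in> elems D \<and> fn (fst R) d = xs ! i \<and> fn (snd R) d = ys ! i"
    using l graphE[OF _ r] unfolding list_all2_conv_all_nth by blast
  then obtain g where g: "\<And>i. i < length xs \<Longrightarrow> g i \<in> elems D \<and> fn (fst R) (g i) = xs ! i \<and> fn (snd R) (g i) = ys ! i"
    by metis
  define ds where "ds = map g [0..<length xs]"
  have ds: "length ds = ar \<sigma>" "set ds \<subseteq> elems D" using g len by (auto simp: ds_def)
  have leq: "length ys = length xs" using list_all2_lengthD[OF l] by simp
  have "map (fn (fst R)) ds = xs" "map (fn (snd R)) ds = ys"
    by (rule nth_equalityI; use g leq in \<open>simp add: ds_def\<close>)+
  then have "fn (fst R) (interp (alg D) \<sigma> ds) = interp (alg A) \<sigma> xs"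
    "fn (snd R) (interp (alg D) \<sigma> ds) = interp (alg B) \<sigma> ys"
    using homomorphisms_app[OF HomD(7)[OF r] ds] homomorphisms_app[OF HomD(7)[OF r'] ds] by simp_all
  moreover have "interp (alg D) \<sigma> ds \<in> elems D"
    using ObjD(2)[OF HomD(1)[OF r]] ds unfolding is_algebra_def by blast
  ultimately show "(interp (alg A) \<sigma> xs, interp (alg B) \<sigma> ys) \<in> graph R"
    unfolding graph_eq[OF r] by (intro image_eqI[of _ _ "interp (alg D) \<sigma> ds"]) simp_all
qed

definition relation_on where
  "relation_on W R \<longleftrightarrow> is_relation C (Dom C (fst R)) W W (fst R) (snd R)"

lemma relation_onD:
  assumes "relation_on W R"
  shows "fst R \<in> Hom C (Dom C (fst R)) W" "snd R \<in> Hom C (Dom C (fst R)) W"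
    "graph R \<subseteq> elems W \<times> elems W" "(a, b) \<in> graph R \<Longrightarrow> prj W a = prj W b"
    "compatible ar (alg W) (alg W) (graph R)" "y \<in> carrier Y \<Longrightarrow> (sec W y, sec W y) \<in> graph R"
    "W \<in> Obj C"
proof -
  show r: "fst R \<in> Hom C (Dom C (fst R)) W" "snd R \<in> Hom C (Dom C (fst R)) W"
    using assms by (auto simp: relation_on_def is_relation_def)
  show "graph R \<subseteq> elems W \<times> elems W" "(a, b) \<in> graph R \<Longrightarrow> prj W a = prj W b"
    "compatible ar (alg W) (alg W) (graph R)" "y \<in> carrier Y \<Longrightarrow> (sec W y, sec W y) \<in> graph R"
    using graph_subset[OF r] graph_prj[OF r] graph_compatible[OF r] graph_sec[OF r] by blast+
  show "W \<in> Obj C" using HomD(2)[OF r(1)] .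
qed

text \<open>From right to left, the elements of the relation object that name the pairs are unique,
  since its legs are jointly injective; so they assemble to the required arrow.\<close>

lemma related_iff:
  assumes R: "relation_on W R" and x: "x \<in> Hom C A W" and y: "y \<in> Hom C A W"
  shows "related C R x y \<longleftrightarrow> (\<forall>a \<in> elems A. (fn x a, fn y a) \<in> graph R)"
proof
  define D where "D = Dom C (fst R)"
  have r: "fst R \<in> Hom C D W" "snd R \<in> Hom C D W"
    and inj: "\<And>d e. d \<in> elems D \<Longrightarrow> e \<in> elems D \<Longrightarrow> fn (fst R) d = fn (fst R) e \<Longrightarrow>
                fn (snd R) d = fn (snd R) e \<Longrightarrow> d = e"
    using R by (auto simp: relation_on_def is_relation_iff D_def)
  { assume "related C R x y"
    then obtain h where h: "h \<in> Hom C A D" "fst R \<odot>\<^bsub>C\<^esub> h = x" "snd R \<odot>\<^bsub>C\<^esub> h = y"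
      using HomD(4)[OF x] by (auto simp: related_def D_def)
    show "\<forall>a \<in> elems A. (fn x a, fn y a) \<in> graph R"
    proof
      fix a assume a: "a \<in> elems A"
      have "fn x a = fn (fst R) (fn h a)" "fn y a = fn (snd R) (fn h a)"
        using fn_Comp[OF h(1) r(1) a] fn_Comp[OF h(1) r(2) a] h by simp_all
      then show "(fn x a, fn y a) \<in> graph R"
        using HomD(8)[OF h(1) a] by (simp add: graph_eq[OF r(1)])
    qed }
  { assume "\<forall>a \<in> elems A. (fn x a, fn y a) \<in> graph R"
    then have ex: "\<exists>d \<in> elems D. fn (fst R) d = fn x a \<and> fn (snd R) d = fn y a" if "a \<in> elems A" for a
      using that unfolding graph_eq[OF r(1)] by fastforce
    have "\<exists>!h. h \<in> Hom C A D \<and> fst R \<odot>\<^bsub>C\<^esub> h = x \<and> snd R \<odot>\<^bsub>C\<^esub> h = y"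
      by (rule lift2[OF r inj x y ex])
    then show "related C R x y"
      using HomD(4)[OF x] unfolding related_def D_def by blast }
qed

text \<open>\<open>R\<close> is any pullback of f along itself. That its graph contains all pairs
  with equal image is seen from a concrete pullback, whose projections realise all these pairs and
  factor through \<open>R\<close>.\<close>

lemma kernel_relation_graph:
  assumes f: "f \<in> Hom C W X" and k: "kernel_relation C f R"
  shows "relation_on W R" "graph R = {(a, b) \<in> elems W \<times> elems W. fn f a = fn f b}"
proof -
  note W = HomD(1)[OF f]
  define D where "D = Dom C (fst R)"
  have pb: "is_pullback C f f (fst R) (snd R)" using k by (simp add: kernel_relation_def)
  have r: "fst R \<in> Hom C D W" "snd R \<in> Hom C D W" and eq: "f \<odot>\<^bsub>C\<^esub> fst R = f \<odot>\<^bsub>C\<^esub> snd R"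
    and univ: "\<And>A a b. A \<in> Obj C \<Longrightarrow> a \<in> Hom C A W \<Longrightarrow> b \<in> Hom C A W \<Longrightarrow> f \<odot>\<^bsub>C\<^esub> a = f \<odot>\<^bsub>C\<^esub> b \<Longrightarrow>
      \<exists>!h. h \<in> Hom C A D \<and> fst R \<odot>\<^bsub>C\<^esub> h = a \<and> snd R \<odot>\<^bsub>C\<^esub> h = b"
    using pb HomD(4)[OF f] Hom_ArrD[of "fst R"] by (simp_all add: is_pullback_def D_def)
  have eq': "fn f (fn (fst R) d) = fn f (fn (snd R) d)" if "d \<in> elems D" for d
    using eq that by (simp add: Comp_eq_Comp_iff[OF r(1) f r(2) f])
  have "h = k" if hk: "A \<in> Obj C" "h \<in> Hom C A D" "k \<in> Hom C A D"
      "fst R \<odot>\<^bsub>C\<^esub> h = fst R \<odot>\<^bsub>C\<^esub> k" "snd R \<odot>\<^bsub>C\<^esub> h = snd R \<odot>\<^bsub>C\<^esub> k" for A h k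
  proof -
    have a: "fst R \<odot>\<^bsub>C\<^esub> h \<in> Hom C A W" "snd R \<odot>\<^bsub>C\<^esub> h \<in> Hom C A W"
      using Comp_in_Hom[OF hk(2)] r by auto
    have "f \<odot>\<^bsub>C\<^esub> (fst R \<odot>\<^bsub>C\<^esub> h) = f \<odot>\<^bsub>C\<^esub> (snd R \<odot>\<^bsub>C\<^esub> h)"
      using eq' HomD(8)[OF hk(2)] fn_Comp[OF hk(2) r(1)] fn_Comp[OF hk(2) r(2)]
      by (simp add: Comp_eq_Comp_iff[OF a(1) f a(2) f])
    from univ[OF hk(1) a this] show ?thesis using hk by metis
  qed
  then show rel: "relation_on W R"
    using r unfolding relation_on_def is_relation_def D_def by blast
  define S where "S = {(a, b) \<in> elems W \<times> elems W. \<forall>i\<in>{()}. fn f a = fn f b}"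
  have c: "compatible ar (alg W) (alg W) S"
    unfolding S_def
    by (rule compatible_equalizer[OF ObjD(2)[OF W] ObjD(2)[OF W] HomD(7)[OF f] HomD(7)[OF f]])
  have pr: "prj W a = prj W b" if "(a, b) \<in> S" for a b
    using that HomD(9)[OF f, of a] HomD(9)[OF f, of b] by (auto simp: S_def)
  have se: "(sec W y, sec W y) \<in> S" if "y \<in> carrier Y" for y
    using that ObjD(6)[OF W] by (auto simp: S_def)
  have sub: "S \<subseteq> elems W \<times> elems W" by (auto simp: S_def)
  obtain q u v where u: "u \<in> Hom C q W" and v: "v \<in> Hom C q W"
    and mem: "\<And>d. d \<in> elems q \<Longrightarrow> (fn u d, fn v d) \<in> S"
    and onto: "\<And>a b. (a, b) \<in> S \<Longrightarrow> \<exists>d \<in> elems q. fn u d = a \<and> fn v d = b"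
    by (rule subproduct2[OF W W sub pr c se]) (assumption | (rule that; assumption))+
  have "f \<odot>\<^bsub>C\<^esub> u = f \<odot>\<^bsub>C\<^esub> v" using mem by (simp add: Comp_eq_Comp_iff[OF u f v f] S_def)
  from univ[OF HomD(1)[OF u] u v this]
  obtain h where h: "h \<in> Hom C q D" "fst R \<odot>\<^bsub>C\<^esub> h = u" "snd R \<odot>\<^bsub>C\<^esub> h = v" by blast
  have "related C R u v"
    using h HomD(4)[OF u] unfolding related_def D_def by blast
  then have "\<forall>d \<in> elems q. (fn u d, fn v d) \<in> graph R" by (simp add: related_iff[OF rel u v])
  then have "S \<subseteq> graph R" using onto by fast
  moreover have "graph R \<subseteq> S"
    using eq' HomD(8)[OF r(1)] HomD(8)[OF r(2)] by (auto simp: graph_eq[OF r(1)] S_def)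
  ultimately show "graph R = {(a, b) \<in> elems W \<times> elems W. fn f a = fn f b}" by (auto simp: S_def)
qed

lemma kernel_relation_exists:
  assumes "f \<in> Hom C W X"
  shows "\<exists>R. kernel_relation C f R"
proof (rule ex_pullback[OF assms assms])
  fix p q assume "is_pullback C f f p q"
  then show ?thesis by (intro exI[of _ "(p, q)"]) (simp add: kernel_relation_def)
qed

text \<open>Each property is tested at a universal generalised element: reflexivity at the identity
  of \<open>W\<close>, symmetry at the two legs of \<open>T\<close>, transitivity at the object of
  composable pairs, the pullback of the second leg along the first.\<close>

lemma equivalence_relation_graph:
  assumes W: "W \<in> Obj C" and T: "equivalence_relation C W T"
  shows "relation_on W T" "equiv (elems W) (graph T)"
proof -
  show rel: "relation_on W T" using T by (simp add: equivalence_relation_def relation_on_def)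
  define D where "D = Dom C (fst T)"
  have t: "fst T \<in> Hom C D W" "snd T \<in> Hom C D W" using relation_onD(1,2)[OF rel] by (simp_all add: D_def)
  have eq: "equiv (Hom C A W) {(x, y) \<in> Hom C A W \<times> Hom C A W. related C T x y}" if "A \<in> Obj C" for A
    using T that by (simp add: equivalence_relation_def)
  have rel_refl: "related C T x x" if "x \<in> Hom C A W" for A x
    using eq[OF HomD(1)[OF that]] that unfolding equiv_def refl_on_def by blast
  have rel_sym: "related C T y x" if "x \<in> Hom C A W" "y \<in> Hom C A W" "related C T x y" for A x y
    using eq[OF HomD(1)[OF that(1)]] that unfolding equiv_def sym_def by blast
  have rel_trans: "related C T x z"
    if "x \<in> Hom C A W" "y \<in> Hom C A W" "z \<in> Hom C A W" "related C T x y" "related C T y z" for A x y z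
    using eq[OF HomD(1)[OF that(1)]] that unfolding equiv_def trans_def by blast
  have "(a, a) \<in> graph T" if "a \<in> elems W" for a
    using rel_refl[OF Id_in_Hom[OF W]] that fn_Id[OF W that]
    by (auto simp: related_iff[OF rel Id_in_Hom[OF W] Id_in_Hom[OF W]])
  moreover have "(b, a) \<in> graph T" if "(a, b) \<in> graph T" for a b
  proof -
    have "related C T (fst T) (snd T)" by (auto simp: related_iff[OF rel t] graph_eq[OF t(1)])
    from rel_sym[OF t this] have "\<forall>d \<in> elems D. (fn (snd T) d, fn (fst T) d) \<in> graph T"
      by (simp add: related_iff[OF rel t(2,1)])
    then show ?thesis using that by (auto simp: graph_eq[OF t(1)])
  qed
  moreover have "(a, c) \<in> graph T" if abc: "(a, b) \<in> graph T" "(b, c) \<in> graph T" for a b c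
  proof -
    note D = HomD(1)[OF t(1)]
    define S where "S = {(d, e) \<in> elems D \<times> elems D. \<forall>i\<in>{()}. fn (snd T) d = fn (fst T) e}"
    have c: "compatible ar (alg D) (alg D) S"
      unfolding S_def
      by (rule compatible_equalizer[OF ObjD(2)[OF D] ObjD(2)[OF D] HomD(7)[OF t(2)] HomD(7)[OF t(1)]])
    have pr: "prj D d = prj D e" if "(d, e) \<in> S" for d e
      using that HomD(9)[OF t(2), of d] HomD(9)[OF t(1), of e] by (auto simp: S_def)
    have se: "(sec D y, sec D y) \<in> S" if "y \<in> carrier Y" for y
      using that ObjD(6)[OF D] HomD(10)[OF t(2)] HomD(10)[OF t(1)] by (auto simp: S_def)
    have sub: "S \<subseteq> elems D \<times> elems D" by (auto simp: S_def)
    obtain q u v where u: "u \<in> Hom C q D" and v: "v \<in> Hom C q D"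
      and mem: "\<And>d. d \<in> elems q \<Longrightarrow> (fn u d, fn v d) \<in> S"
      and onto: "\<And>a b. (a, b) \<in> S \<Longrightarrow> \<exists>d \<in> elems q. fn u d = a \<and> fn v d = b"
      by (rule subproduct2[OF D D sub pr c se]) (assumption | (rule that; assumption))+
    define x y z where "x = fst T \<odot>\<^bsub>C\<^esub> u" and "y = snd T \<odot>\<^bsub>C\<^esub> u" and "z = snd T \<odot>\<^bsub>C\<^esub> v"
    have xyz: "x \<in> Hom C q W" "y \<in> Hom C q W" "z \<in> Hom C q W"
      using Comp_in_Hom[OF u] Comp_in_Hom[OF v] t by (auto simp: x_def y_def z_def)
    have y: "y = fst T \<odot>\<^bsub>C\<^esub> v"
      using mem by (simp add: y_def Comp_eq_Comp_iff[OF u t(2) v t(1)] S_def)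
    have "related C T x y" "related C T y z"
      using u v HomD(4)[OF xyz(1)] HomD(4)[OF xyz(2)]
      unfolding related_def D_def[symmetric] y by (auto simp: x_def z_def y y_def[symmetric])
    from rel_trans[OF xyz this] have xz: "\<forall>d \<in> elems q. (fn x d, fn z d) \<in> graph T"
      by (simp add: related_iff[OF rel xyz(1,3)])
    obtain d e where "d \<in> elems D" "e \<in> elems D" "fn (fst T) d = a" "fn (snd T) d = b"
      "fn (fst T) e = b" "fn (snd T) e = c"
      using abc by (auto simp: graph_eq[OF t(1)])
    moreover from this obtain j where "j \<in> elems q" "fn u j = d" "fn v j = e"
      using onto[of d e] by (auto simp: S_def)
    ultimately show ?thesis
      using xz fn_Comp[OF u t(1)] fn_Comp[OF v t(2)] by (auto simp: x_def z_def)
  qed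
  ultimately show "equiv (elems W) (graph T)"
    using relation_onD(3)[OF rel] unfolding equiv_def refl_on_def sym_def trans_def by blast
qed

section \<open>The objects of triples and of quadruples, and the comparison map between them\<close>

lemma times1_exists:
  assumes R: "relation_on W R" and T: "relation_on W T"
  shows "\<exists>Q x y z. is_times1 C W R T Q x y z \<and> (\<forall>a b c. (a, b) \<in> graph R \<and> (b, c) \<in> graph T \<longrightarrow>
           (\<exists>q \<in> elems Q. fn x q = a \<and> fn y q = b \<and> fn z q = c))"
proof -
  have W: "W \<in> Obj C" using relation_onD(7)[OF R] .
  define B where "B = {b \<in> (\<Pi>\<^sub>E i\<in>{..<3::nat}. elems W). (b 0, b 1) \<in> graph R \<and> (b 1, b 2) \<in> graph T}"
  have cl: "(\<lambda>i\<in>{..<3}. interp (alg W) \<sigma> (map (\<lambda>b. b i) bs)) \<in> B"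
    if bs: "length bs = ar \<sigma>" "set bs \<subseteq> B" for \<sigma> bs
  proof -
    have "(interp (alg W) \<sigma> (map (\<lambda>b. b 0) bs), interp (alg W) \<sigma> (map (\<lambda>b. b 1) bs)) \<in> graph R"
      by (rule compatibleD[OF relation_onD(5)[OF R] bs(1)]) (use bs(2) in \<open>auto simp: B_def\<close>)
    moreover have "(interp (alg W) \<sigma> (map (\<lambda>b. b 1) bs), interp (alg W) \<sigma> (map (\<lambda>b. b 2) bs)) \<in> graph T"
      by (rule compatibleD[OF relation_onD(5)[OF T] bs(1)]) (use bs(2) in \<open>auto simp: B_def\<close>)
    moreover from calculation have "\<forall>i<3. interp (alg W) \<sigma> (map (\<lambda>b. b i) bs) \<in> elems W"
      using relation_onD(3)[OF R] relation_onD(3)[OF T] unfolding all_less3 by blast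
    ultimately show ?thesis by (simp add: B_def restrict_PiE_iff)
  qed
  have sec: "(\<lambda>i\<in>{..<3}. sec W y) \<in> B" if "y \<in> carrier Y" for y
    using relation_onD(6)[OF R that] relation_onD(6)[OF T that] ObjD(6)[OF W that] by (auto simp: B_def)
  have prj: "prj W (b i) = prj W (b 0)" if b: "b \<in> B" and i: "i < 3" for b i
  proof -
    have "\<forall>i<3. prj W (b i) = prj W (b 0)"
      using b relation_onD(4)[OF R, of "b 0" "b 1"] relation_onD(4)[OF T, of "b 1" "b 2"]
      by (simp add: all_less3 B_def)
    then show ?thesis using i by blast
  qed
  have sub: "B \<subseteq> (\<Pi>\<^sub>E i\<in>{..<3}. elems W)" by (auto simp: B_def)
  show ?thesis
  proof (rule exE[OF subproduct_point[OF W zero_less_numeral sub prj cl sec]], assumption+, elim exE conjE)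
    fix q \<pi>
    assume q: "q \<in> Obj C" and \<pi>: "\<forall>i<3. \<pi> i \<in> Hom C q W"
      and inj: "\<forall>a \<in> elems q. \<forall>b \<in> elems q. (\<forall>i<3. fn (\<pi> i) a = fn (\<pi> i) b) \<longrightarrow> a = b"
      and mem: "\<forall>a \<in> elems q. (\<lambda>i\<in>{..<3}. fn (\<pi> i) a) \<in> B"
      and onto: "\<forall>b \<in> B. \<exists>a \<in> elems q. \<forall>i<3. fn (\<pi> i) a = b i"
    have \<pi>': "\<pi> 0 \<in> Hom C q W" "\<pi> 1 \<in> Hom C q W" "\<pi> 2 \<in> Hom C q W" using \<pi> by (simp_all add: all_less3)
    have onto': "\<exists>d \<in> elems q. fn (\<pi> 0) d = a \<and> fn (\<pi> 1) d = b \<and> fn (\<pi> 2) d = c"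
      if "(a, b) \<in> graph R" "(b, c) \<in> graph T" for a b c
    proof -
      have "(\<lambda>i\<in>{..<3}. [a, b, c] ! i) \<in> B"
      proof -
        have "\<forall>i<3. [a, b, c] ! i \<in> elems W"
          using that relation_onD(3)[OF R] relation_onD(3)[OF T] unfolding all_less3 by auto
        then show ?thesis using that by (simp add: B_def restrict_PiE_iff)
      qed
      from bspec[OF onto this] show ?thesis by (simp add: all_less3)
    qed
    have univ: "\<exists>!h. h \<in> Hom C A q \<and> \<pi> 0 \<odot>\<^bsub>C\<^esub> h = x' \<and> \<pi> 1 \<odot>\<^bsub>C\<^esub> h = y' \<and> \<pi> 2 \<odot>\<^bsub>C\<^esub> h = z'"
      if A: "A \<in> Obj C" "x' \<in> Hom C A W" "y' \<in> Hom C A W" "z' \<in> Hom C A W"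
        and rel: "related C R x' y'" "related C T y' z'" for A x' y' z'
    proof -
      have "\<exists>!h. h \<in> Hom C A q \<and> (\<forall>i\<in>{..<3}. \<pi> i \<odot>\<^bsub>C\<^esub> h = [x', y', z'] ! i)"
      proof (rule lift[where p = "\<lambda>_. W"])
        show "\<exists>d \<in> elems q. \<forall>i\<in>{..<3}. fn (\<pi> i) d = fn ([x', y', z'] ! i) a" if a: "a \<in> elems A" for a
        proof -
          have "(fn x' a, fn y' a) \<in> graph R" "(fn y' a, fn z' a) \<in> graph T"
            using rel a related_iff[OF R A(2,3)] related_iff[OF T A(3,4)] by auto
          from onto'[OF this] show ?thesis by (simp add: all_less3 Ball_def)
        qed
        show "[x', y', z'] ! i \<in> Hom C A W" if "i \<in> {..<3}" for i
          using A that by (auto simp: numeral_eq_Suc less_Suc_eq)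
        show "\<pi> i \<in> Hom C q W" if "i \<in> {..<3}" for i using \<pi> that by simp
        show "d = e" if "d \<in> elems q" "e \<in> elems q" "\<And>i. i \<in> {..<3} \<Longrightarrow> fn (\<pi> i) d = fn (\<pi> i) e" for d e
          using inj that by simp
      qed (use A q in \<open>auto simp: lessThan_empty_iff\<close>)
      then show ?thesis by (simp add: all_less3 Ball_def)
    qed
    have rel: "related C R (\<pi> 0) (\<pi> 1)" "related C T (\<pi> 1) (\<pi> 2)"
      unfolding related_iff[OF R \<pi>'(1,2)] related_iff[OF T \<pi>'(2,3)] using mem by (auto simp: B_def)
    have "is_times1 C W R T q (\<pi> 0) (\<pi> 1) (\<pi> 2)"
      unfolding is_times1_def using q \<pi>' rel univ by blast
    then show ?thesis using onto' by blast
  qed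
qed

lemma box_exists:
  assumes R: "relation_on W R" and T: "relation_on W T"
  shows "\<exists>P x y t z. is_box C W R T P x y t z \<and>
    (\<forall>a b c d. (a, b) \<in> graph R \<and> (c, d) \<in> graph R \<and> (a, c) \<in> graph T \<and> (b, d) \<in> graph T \<longrightarrow>
           (\<exists>p \<in> elems P. fn x p = a \<and> fn y p = b \<and> fn t p = c \<and> fn z p = d))"
proof -
  have W: "W \<in> Obj C" using relation_onD(7)[OF R] .
  define B where "B = {b \<in> (\<Pi>\<^sub>E i\<in>{..<4::nat}. elems W).
    (b 0, b 1) \<in> graph R \<and> (b 2, b 3) \<in> graph R \<and> (b 0, b 2) \<in> graph T \<and> (b 1, b 3) \<in> graph T}"
  have cl: "(\<lambda>i\<in>{..<4}. interp (alg W) \<sigma> (map (\<lambda>b. b i) bs)) \<in> B"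
    if bs: "length bs = ar \<sigma>" "set bs \<subseteq> B" for \<sigma> bs
  proof -
    have "(interp (alg W) \<sigma> (map (\<lambda>b. b i) bs), interp (alg W) \<sigma> (map (\<lambda>b. b j) bs)) \<in> graph R"
      if "(i, j) \<in> {(0, 1), (2, 3)}" for i j
      by (rule compatibleD[OF relation_onD(5)[OF R] bs(1)]) (use bs(2) that in \<open>auto simp: B_def\<close>)
    moreover have "(interp (alg W) \<sigma> (map (\<lambda>b. b i) bs), interp (alg W) \<sigma> (map (\<lambda>b. b j) bs)) \<in> graph T"
      if "(i, j) \<in> {(0, 2), (1, 3)}" for i j
      by (rule compatibleD[OF relation_onD(5)[OF T] bs(1)]) (use bs(2) that in \<open>auto simp: B_def\<close>)
    ultimately have h: "(interp (alg W) \<sigma> (map (\<lambda>b. b 0) bs), interp (alg W) \<sigma> (map (\<lambda>b. b 1) bs)) \<in> graph R"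
      "(interp (alg W) \<sigma> (map (\<lambda>b. b 2) bs), interp (alg W) \<sigma> (map (\<lambda>b. b 3) bs)) \<in> graph R"
      "(interp (alg W) \<sigma> (map (\<lambda>b. b 0) bs), interp (alg W) \<sigma> (map (\<lambda>b. b 2) bs)) \<in> graph T"
      "(interp (alg W) \<sigma> (map (\<lambda>b. b 1) bs), interp (alg W) \<sigma> (map (\<lambda>b. b 3) bs)) \<in> graph T"
      by blast+
    then have "\<forall>i<4. interp (alg W) \<sigma> (map (\<lambda>b. b i) bs) \<in> elems W"
      using relation_onD(3)[OF R] unfolding all_less4 by blast
    then show ?thesis using h by (simp add: B_def restrict_PiE_iff)
  qed
  have sec: "(\<lambda>i\<in>{..<4}. sec W y) \<in> B" if "y \<in> carrier Y" for y
    using relation_onD(6)[OF R that] relation_onD(6)[OF T that] ObjD(6)[OF W that] by (auto simp: B_def)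
  have prj: "prj W (b i) = prj W (b 0)" if b: "b \<in> B" and i: "i < 4" for b i
  proof -
    have "\<forall>i<4. prj W (b i) = prj W (b 0)"
      using b relation_onD(4)[OF R, of "b 0" "b 1"] relation_onD(4)[OF R, of "b 2" "b 3"]
        relation_onD(4)[OF T, of "b 0" "b 2"]
      by (simp add: all_less4 B_def)
    then show ?thesis using i by blast
  qed
  have sub: "B \<subseteq> (\<Pi>\<^sub>E i\<in>{..<4}. elems W)" by (auto simp: B_def)
  show ?thesis
  proof (rule exE[OF subproduct_point[OF W zero_less_numeral sub prj cl sec]], assumption+, elim exE conjE)
    fix q \<pi>
    assume q: "q \<in> Obj C" and \<pi>: "\<forall>i<4. \<pi> i \<in> Hom C q W"
      and inj: "\<forall>a \<in> elems q. \<forall>b \<in> elems q. (\<forall>i<4. fn (\<pi> i) a = fn (\<pi> i) b) \<longrightarrow> a = b"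
      and mem: "\<forall>a \<in> elems q. (\<lambda>i\<in>{..<4}. fn (\<pi> i) a) \<in> B"
      and onto: "\<forall>b \<in> B. \<exists>a \<in> elems q. \<forall>i<4. fn (\<pi> i) a = b i"
    have \<pi>': "\<pi> 0 \<in> Hom C q W" "\<pi> 1 \<in> Hom C q W" "\<pi> 2 \<in> Hom C q W" "\<pi> 3 \<in> Hom C q W"
      using \<pi> by (simp_all add: all_less4)
    have onto': "\<exists>p \<in> elems q. fn (\<pi> 0) p = a \<and> fn (\<pi> 1) p = b \<and> fn (\<pi> 2) p = c \<and> fn (\<pi> 3) p = d"
      if "(a, b) \<in> graph R" "(c, d) \<in> graph R" "(a, c) \<in> graph T" "(b, d) \<in> graph T" for a b c d
    proof -
      have "(\<lambda>i\<in>{..<4}. [a, b, c, d] ! i) \<in> B"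
      proof -
        have "\<forall>i<4. [a, b, c, d] ! i \<in> elems W"
          using that relation_onD(3)[OF R] unfolding all_less4 by auto
        then show ?thesis using that by (simp add: B_def restrict_PiE_iff)
      qed
      from bspec[OF onto this] show ?thesis by (simp add: all_less4)
    qed
    have univ: "\<exists>!h. h \<in> Hom C A q \<and> \<pi> 0 \<odot>\<^bsub>C\<^esub> h = x' \<and> \<pi> 1 \<odot>\<^bsub>C\<^esub> h = y' \<and> \<pi> 2 \<odot>\<^bsub>C\<^esub> h = t' \<and> \<pi> 3 \<odot>\<^bsub>C\<^esub> h = z'"
      if A: "A \<in> Obj C" "x' \<in> Hom C A W" "y' \<in> Hom C A W" "t' \<in> Hom C A W" "z' \<in> Hom C A W"
        and rel: "related C R x' y'" "related C R t' z'" "related C T x' t'" "related C T y' z'" for A x' y' t' z'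
    proof -
      have "\<exists>!h. h \<in> Hom C A q \<and> (\<forall>i\<in>{..<4}. \<pi> i \<odot>\<^bsub>C\<^esub> h = [x', y', t', z'] ! i)"
      proof (rule lift[where p = "\<lambda>_. W"])
        show "\<exists>d \<in> elems q. \<forall>i\<in>{..<4}. fn (\<pi> i) d = fn ([x', y', t', z'] ! i) a" if a: "a \<in> elems A" for a
        proof -
          have "(fn x' a, fn y' a) \<in> graph R" "(fn t' a, fn z' a) \<in> graph R"
            "(fn x' a, fn t' a) \<in> graph T" "(fn y' a, fn z' a) \<in> graph T"
            using rel a related_iff[OF R A(2,3)] related_iff[OF R A(4,5)]
              related_iff[OF T A(2,4)] related_iff[OF T A(3,5)] by auto
          from onto'[OF this] show ?thesis by (simp add: all_less4 Ball_def)
        qed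
        show "[x', y', t', z'] ! i \<in> Hom C A W" if "i \<in> {..<4}" for i
          using A that by (auto simp: numeral_eq_Suc less_Suc_eq)
        show "\<pi> i \<in> Hom C q W" if "i \<in> {..<4}" for i using \<pi> that by simp
        show "d = e" if "d \<in> elems q" "e \<in> elems q" "\<And>i. i \<in> {..<4} \<Longrightarrow> fn (\<pi> i) d = fn (\<pi> i) e" for d e
          using inj that by simp
      qed (use A q in \<open>auto simp: lessThan_empty_iff\<close>)
      then show ?thesis by (simp add: all_less4 Ball_def)
    qed
    have rel: "related C R (\<pi> 0) (\<pi> 1)" "related C R (\<pi> 2) (\<pi> 3)" "related C T (\<pi> 0) (\<pi> 2)" "related C T (\<pi> 1) (\<pi> 3)"
      unfolding related_iff[OF R \<pi>'(1,2)] related_iff[OF R \<pi>'(3,4)]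
        related_iff[OF T \<pi>'(1,3)] related_iff[OF T \<pi>'(2,4)]
      using mem by (auto simp: B_def)
    have "is_box C W R T q (\<pi> 0) (\<pi> 1) (\<pi> 2) (\<pi> 3)"
      unfolding is_box_def using q \<pi>' rel univ by blast
    then show ?thesis using onto' by blast
  qed
qed

text \<open>The concrete model of \<open>times1_exists\<close> maps to the given object by its
  universal property, which provides an element for every admissible triple; uniqueness is joint
  monicity of the three projections.\<close>

lemma is_times1_elements:
  assumes R: "relation_on W R" and T: "relation_on W T" and Q: "is_times1 C W R T Q x y z"
  shows "\<And>q. q \<in> elems Q \<Longrightarrow> (fn x q, fn y q) \<in> graph R \<and> (fn y q, fn z q) \<in> graph T"
    "\<And>q r. q \<in> elems Q \<Longrightarrow> r \<in> elems Q \<Longrightarrow> fn x q = fn x r \<Longrightarrow> fn y q = fn y r \<Longrightarrow> fn z q = fn z r \<Longrightarrow> q = r"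
    "\<And>a b c. (a, b) \<in> graph R \<Longrightarrow> (b, c) \<in> graph T \<Longrightarrow> \<exists>q \<in> elems Q. fn x q = a \<and> fn y q = b \<and> fn z q = c"
proof -
  have xyz: "x \<in> Hom C Q W" "y \<in> Hom C Q W" "z \<in> Hom C Q W" and rel: "related C R x y" "related C T y z"
    using Q unfolding is_times1_def by blast+
  show "(fn x q, fn y q) \<in> graph R \<and> (fn y q, fn z q) \<in> graph T" if "q \<in> elems Q" for q
    using rel that by (simp add: related_iff[OF R xyz(1,2)] related_iff[OF T xyz(2,3)])
  have univ: "\<exists>!h. h \<in> Hom C A Q \<and> x \<odot>\<^bsub>C\<^esub> h = x' \<and> y \<odot>\<^bsub>C\<^esub> h = y' \<and> z \<odot>\<^bsub>C\<^esub> h = z'"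
    if "A \<in> Obj C" "x' \<in> Hom C A W" "y' \<in> Hom C A W" "z' \<in> Hom C A W" "related C R x' y'" "related C T y' z'"
    for A x' y' z'
    using Q that unfolding is_times1_def by blast
  show "q = r" if qr: "q \<in> elems Q" "r \<in> elems Q" "fn x q = fn x r" "fn y q = fn y r" "fn z q = fn z r" for q r
  proof (rule jointly_monic_imp_injective[where I = "{0, 1, 2}" and \<pi> = "\<lambda>i. [x, y, z] ! i" and p = "\<lambda>_. W"])
    show "h = k" if hk: "A \<in> Obj C" "h \<in> Hom C A Q" "k \<in> Hom C A Q"
      "\<And>i. i \<in> {0, 1, 2} \<Longrightarrow> [x, y, z] ! i \<odot>\<^bsub>C\<^esub> h = [x, y, z] ! i \<odot>\<^bsub>C\<^esub> k" for A h k
    proof -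
      have eq: "x \<odot>\<^bsub>C\<^esub> h = x \<odot>\<^bsub>C\<^esub> k" "y \<odot>\<^bsub>C\<^esub> h = y \<odot>\<^bsub>C\<^esub> k" "z \<odot>\<^bsub>C\<^esub> h = z \<odot>\<^bsub>C\<^esub> k"
        using hk(4)[of 0] hk(4)[of 1] hk(4)[of 2] by simp_all
      have c: "x \<odot>\<^bsub>C\<^esub> h \<in> Hom C A W" "y \<odot>\<^bsub>C\<^esub> h \<in> Hom C A W" "z \<odot>\<^bsub>C\<^esub> h \<in> Hom C A W"
        using Comp_in_Hom[OF hk(2)] xyz by blast+
      have "related C R (x \<odot>\<^bsub>C\<^esub> h) (y \<odot>\<^bsub>C\<^esub> h)" "related C T (y \<odot>\<^bsub>C\<^esub> h) (z \<odot>\<^bsub>C\<^esub> h)"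
        using rel HomD(8)[OF hk(2)] fn_Comp[OF hk(2)] xyz
        by (simp_all add: related_iff[OF R c(1,2)] related_iff[OF T c(2,3)] related_iff[OF R xyz(1,2)]
            related_iff[OF T xyz(2,3)])
      from univ[OF hk(1) c this] show ?thesis using hk(2,3) eq by metis
    qed
  qed (use xyz qr in auto)
  show "\<exists>q \<in> elems Q. fn x q = a \<and> fn y q = b \<and> fn z q = c"
    if abc: "(a, b) \<in> graph R" "(b, c) \<in> graph T" for a b c
  proof -
    obtain Q' x' y' z' where Q': "is_times1 C W R T Q' x' y' z'"
      and ex: "\<exists>q \<in> elems Q'. fn x' q = a \<and> fn y' q = b \<and> fn z' q = c"
      using times1_exists[OF R T] abc by blast
    from Q' have "Q' \<in> Obj C" "x' \<in> Hom C Q' W" "y' \<in> Hom C Q' W" "z' \<in> Hom C Q' W"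
      "related C R x' y'" "related C T y' z'"
      unfolding is_times1_def by blast+
    from univ[OF this] obtain h where h: "h \<in> Hom C Q' Q"
      and "x \<odot>\<^bsub>C\<^esub> h = x'" "y \<odot>\<^bsub>C\<^esub> h = y'" "z \<odot>\<^bsub>C\<^esub> h = z'" by blast
    moreover obtain q where "q \<in> elems Q'" "fn x' q = a" "fn y' q = b" "fn z' q = c" using ex by blast
    ultimately show ?thesis
      using HomD(8)[OF h] fn_Comp[OF h xyz(1)] fn_Comp[OF h xyz(2)] fn_Comp[OF h xyz(3)]
      by (intro bexI[of _ "fn h q"]) auto
  qed
qed

text \<open>What permutability uses is kept: each element supplies a corner t that leads from x by
  \<open>T\<close> and on to z by \<open>R\<close>, and every square of related elements is realised
  with its corners x, y, z.\<close>

lemma is_box_elements: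
  assumes R: "relation_on W R" and T: "relation_on W T" and P: "is_box C W R T P x y t z"
  shows "\<And>p. p \<in> elems P \<Longrightarrow> (fn x p, fn t p) \<in> graph T \<and> (fn t p, fn z p) \<in> graph R"
    "\<And>a b c d. (a, b) \<in> graph R \<Longrightarrow> (c, d) \<in> graph R \<Longrightarrow> (a, c) \<in> graph T \<Longrightarrow> (b, d) \<in> graph T \<Longrightarrow>
       \<exists>p \<in> elems P. fn x p = a \<and> fn y p = b \<and> fn z p = d"
proof -
  have xyz: "x \<in> Hom C P W" "y \<in> Hom C P W" "t \<in> Hom C P W" "z \<in> Hom C P W"
    and rel: "related C R t z" "related C T x t"
    using P unfolding is_box_def by blast+
  show "(fn x p, fn t p) \<in> graph T \<and> (fn t p, fn z p) \<in> graph R" if "p \<in> elems P" for p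
    using rel that by (simp add: related_iff[OF R xyz(3,4)] related_iff[OF T xyz(1,3)])
  have univ: "\<exists>!h. h \<in> Hom C A P \<and> x \<odot>\<^bsub>C\<^esub> h = x' \<and> y \<odot>\<^bsub>C\<^esub> h = y' \<and> t \<odot>\<^bsub>C\<^esub> h = t' \<and> z \<odot>\<^bsub>C\<^esub> h = z'"
    if "A \<in> Obj C" "x' \<in> Hom C A W" "y' \<in> Hom C A W" "t' \<in> Hom C A W" "z' \<in> Hom C A W"
      "related C R x' y'" "related C R t' z'" "related C T x' t'" "related C T y' z'"
    for A x' y' t' z'
    using P that unfolding is_box_def by blast
  show "\<exists>p \<in> elems P. fn x p = a \<and> fn y p = b \<and> fn z p = d"
    if abcd: "(a, b) \<in> graph R" "(c, d) \<in> graph R" "(a, c) \<in> graph T" "(b, d) \<in> graph T" for a b c d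
  proof -
    obtain P' x' y' t' z' where P': "is_box C W R T P' x' y' t' z'"
      and ex: "\<exists>p \<in> elems P'. fn x' p = a \<and> fn y' p = b \<and> fn t' p = c \<and> fn z' p = d"
      using box_exists[OF R T] abcd by blast
    from P' have "P' \<in> Obj C" "x' \<in> Hom C P' W" "y' \<in> Hom C P' W" "t' \<in> Hom C P' W" "z' \<in> Hom C P' W"
      "related C R x' y'" "related C R t' z'" "related C T x' t'" "related C T y' z'"
      unfolding is_box_def by blast+
    from univ[OF this] obtain h where h: "h \<in> Hom C P' P"
      and "x \<odot>\<^bsub>C\<^esub> h = x'" "y \<odot>\<^bsub>C\<^esub> h = y'" "z \<odot>\<^bsub>C\<^esub> h = z'" by blast
    moreover obtain p where "p \<in> elems P'" "fn x' p = a" "fn y' p = b" "fn z' p = d" using ex by blast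
    ultimately show ?thesis
      using HomD(8)[OF h] fn_Comp[OF h xyz(1)] fn_Comp[OF h xyz(2)] fn_Comp[OF h xyz(4)]
      by (intro bexI[of _ "fn h p"]) auto
  qed
qed

lemma zeta_exists:
  assumes R: "relation_on W R" and T: "relation_on W T"
  shows "\<exists>\<zeta>. is_zeta C W R T \<zeta>"
proof -
  obtain P x y t z where P: "is_box C W R T P x y t z" using box_exists[OF R T] by blast
  obtain Q x' y' z' where Q: "is_times1 C W R T Q x' y' z'" using times1_exists[OF R T] by blast
  have "P \<in> Obj C" "x \<in> Hom C P W" "y \<in> Hom C P W" "z \<in> Hom C P W" "related C R x y" "related C T y z"
    using P unfolding is_box_def by blast+
  then obtain \<zeta> where "\<zeta> \<in> Hom C P Q" "x' \<odot>\<^bsub>C\<^esub> \<zeta> = x" "y' \<odot>\<^bsub>C\<^esub> \<zeta> = y" "z' \<odot>\<^bsub>C\<^esub> \<zeta> = z"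
    using Q unfolding is_times1_def by blast
  then show ?thesis using P Q unfolding is_zeta_def by blast
qed

text \<open>An element of the codomain is a chain a \<open>R\<close> b \<open>T\<close> c. A
  preimage is exactly a fourth corner d with a \<open>T\<close> d \<open>R\<close> c, so
  surjectivity says that \<open>R\<close> followed by \<open>T\<close> is contained in
  \<open>T\<close> followed by \<open>R\<close>.\<close>

lemma zeta_surjective_iff:
  assumes R: "relation_on W R" and T: "relation_on W T" and \<zeta>: "is_zeta C W R T \<zeta>"
  shows "\<zeta> \<in> Hom C (Dom C \<zeta>) (Cod C \<zeta>)"
    "(\<forall>q \<in> elems (Cod C \<zeta>). \<exists>p \<in> elems (Dom C \<zeta>). fn \<zeta> p = q) \<longleftrightarrow> graph R O graph T \<subseteq> graph T O graph R"
proof -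
  obtain P x y t z Q x' y' z' where P: "is_box C W R T P x y t z" and Q: "is_times1 C W R T Q x' y' z'"
    and z: "\<zeta> \<in> Hom C P Q" and c: "x' \<odot>\<^bsub>C\<^esub> \<zeta> = x" "y' \<odot>\<^bsub>C\<^esub> \<zeta> = y" "z' \<odot>\<^bsub>C\<^esub> \<zeta> = z"
    using \<zeta> unfolding is_zeta_def by blast
  have PQ: "Dom C \<zeta> = P" "Cod C \<zeta> = Q" using HomD(4,5)[OF z] by auto
  show "\<zeta> \<in> Hom C (Dom C \<zeta>) (Cod C \<zeta>)" using z PQ by simp
  have h: "x' \<in> Hom C Q W" "y' \<in> Hom C Q W" "z' \<in> Hom C Q W" using Q unfolding is_times1_def by blast+
  have c': "fn x' (fn \<zeta> p) = fn x p" "fn y' (fn \<zeta> p) = fn y p" "fn z' (fn \<zeta> p) = fn z p" if "p \<in> elems P" for p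
    using fn_Comp[OF z h(1) that] fn_Comp[OF z h(2) that] fn_Comp[OF z h(3) that] c by simp_all
  note Qe = is_times1_elements[OF R T Q] and Pe = is_box_elements[OF R T P]
  show "(\<forall>q \<in> elems (Cod C \<zeta>). \<exists>p \<in> elems (Dom C \<zeta>). fn \<zeta> p = q) \<longleftrightarrow> graph R O graph T \<subseteq> graph T O graph R"
    unfolding PQ
  proof
    assume surj: "\<forall>q \<in> elems Q. \<exists>p \<in> elems P. fn \<zeta> p = q"
    show "graph R O graph T \<subseteq> graph T O graph R"
    proof clarify
      fix a b c assume "(a, b) \<in> graph R" "(b, c) \<in> graph T"
      then obtain q where q: "q \<in> elems Q" "fn x' q = a" "fn z' q = c" using Qe(3) by blast
      then obtain p where p: "p \<in> elems P" "fn \<zeta> p = q" using surj by blast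
      then have "(a, fn t p) \<in> graph T" "(fn t p, c) \<in> graph R" using Pe(1)[OF p(1)] c'[OF p(1)] q by auto
      then show "(a, c) \<in> graph T O graph R" by blast
    qed
  next
    assume perm: "graph R O graph T \<subseteq> graph T O graph R"
    show "\<forall>q \<in> elems Q. \<exists>p \<in> elems P. fn \<zeta> p = q"
    proof
      fix q assume q: "q \<in> elems Q"
      have m: "(fn x' q, fn y' q) \<in> graph R" "(fn y' q, fn z' q) \<in> graph T" using Qe(1)[OF q] by auto
      then obtain d where "(fn x' q, d) \<in> graph T" "(d, fn z' q) \<in> graph R" using perm by blast
      then obtain p where p: "p \<in> elems P" "fn x p = fn x' q" "fn y p = fn y' q" "fn z p = fn z' q"
        using Pe(2) m by blast
      have "fn \<zeta> p = q" by (rule Qe(2)[OF HomD(8)[OF z p(1)] q]) (use c'[OF p(1)] p in auto)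
      then show "\<exists>p \<in> elems P. fn \<zeta> p = q" using p(1) by blast
    qed
  qed
qed

text \<open>An invertible comparison map is onto, so a step along R[f] followed by one along R[g]
  can be replaced by steps in the opposite order.\<close>

lemma difunctional_permute:
  assumes f: "f \<in> Hom C W X" and g: "g \<in> Hom C W Z" and d: "difunctional C W f g"
    and abc: "a \<in> elems W" "b \<in> elems W" "c \<in> elems W" "fn f a = fn f b" "fn g b = fn g c"
  shows "\<exists>e \<in> elems W. fn g a = fn g e \<and> fn f e = fn f c"
proof -
  obtain R where R: "kernel_relation C f R" using kernel_relation_exists[OF f] by blast
  obtain S where S: "kernel_relation C g S" using kernel_relation_exists[OF g] by blast
  note Rg = kernel_relation_graph[OF f R] and Sg = kernel_relation_graph[OF g S]
  obtain \<zeta> where \<zeta>: "is_zeta C W R S \<zeta>" using zeta_exists[OF Rg(1) Sg(1)] by blast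
  have "iso_arr C \<zeta>" using d R S \<zeta> unfolding difunctional_def by blast
  then have "graph R O graph S \<subseteq> graph S O graph R"
    using iso_surjective zeta_surjective_iff[OF Rg(1) Sg(1) \<zeta>] by blast
  moreover have "(a, c) \<in> graph R O graph S" using abc Rg(2) Sg(2) by auto
  ultimately show ?thesis using Rg(2) Sg(2) by auto
qed

end

section \<open>From right punctual difunctional relations to permutability and back to
  arrows\<close>

theorem proposition5p2:
  fixes ar :: "'f \<Rightarrow> nat" and V :: "('f, 'u) algebra set" and Y :: "('f, 'u) algebra"
  assumes "adequate_universe TYPE('f) TYPE('u)"
    and "congruence_modular_variety ar V"
    and "Y \<in> V"
  shows "axiom_star (Pt (alg_cat ar V) Y)"
proof -
  obtain E where E: "\<forall>(s, t) \<in> E. wf_trm ar s \<and> wf_trm ar t" "V = {A. is_algebra ar A \<and> satisfies A E}"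
    using assms(2) by (auto simp: congruence_modular_variety_def variety_def)
  interpret point_fibre ar V E Y
    using assms(1,3) E by unfold_locales (auto simp: adequate_universe_def)
  have "extremal_epi C \<zeta>"
    if rel: "is_relation C W X Z f g" and rp: "right_punctual C W Z f g" and dif: "difunctional C W f g"
      and T: "equivalence_relation C W T" and R: "kernel_relation C f R" and \<zeta>: "is_zeta C W R T \<zeta>"
    for W X Z f g T R \<zeta>
  proof -
    have f: "f \<in> Hom C W X" and g: "g \<in> Hom C W Z"
      and inj: "\<And>a b. a \<in> elems W \<Longrightarrow> b \<in> elems W \<Longrightarrow> fn f a = fn f b \<Longrightarrow> fn g a = fn g b \<Longrightarrow> a = b"
      using rel unfolding is_relation_iff by blast+
    note W = HomD(1)[OF f]
    note Rg = kernel_relation_graph[OF f R] and Tg = equivalence_relation_graph[OF W T]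
    obtain t where t: "t \<in> Hom C Z W" and gt: "g \<odot>\<^bsub>C\<^esub> t = Id C Z" and ft: "zero_arr C (f \<odot>\<^bsub>C\<^esub> t)"
      using rp unfolding right_punctual_def by blast
    note Z = HomD(1)[OF t]
    have gt': "fn g (fn t z) = z" and ft': "fn f (fn t z) = sec X (prj Z z)" if "z \<in> elems Z" for z
      using fn_Comp[OF t g that] fn_Comp[OF t f that] fn_Id[OF Z that] gt
        zero_arr_fn[OF ft Comp_in_Hom[OF t f] that] by simp_all
    have full: "\<exists>c \<in> elems W. fn f c = fn f a \<and> fn g c = fn g b"
      if ab: "a \<in> elems W" "b \<in> elems W" "prj W a = prj W b" for a b
    proof -
      have ga: "fn g a \<in> elems Z" "fn g b \<in> elems Z" using HomD(8)[OF g] ab by auto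
      \<comment> \<open>Both sides are the section value of \<open>X\<close> over the common point
        of \<open>Y\<close> below a and b; this is where equality of the projections enters.\<close>
      have "fn f (fn t (fn g b)) = fn f (fn t (fn g a))"
        using ft' ga HomD(9)[OF g] ab by simp
      from difunctional_permute[OF f g dif HomD(8)[OF t ga(2)] HomD(8)[OF t ga(1)] ab(1) this]
      show ?thesis using gt' ga by auto
    qed
    \<comment> \<open>This inclusion makes the comparison map onto, and surjective arrows are
      extremal epimorphisms.\<close>
    have "graph R O graph T \<subseteq> graph T O graph R"
    proof clarify
      fix x y z assume xy: "(x, y) \<in> graph R" and yz: "(y, z) \<in> graph T"
      have xy': "x \<in> elems W" "y \<in> elems W" "fn f x = fn f y" using xy Rg(2) by auto
      have "\<exists>t \<in> elems W. (x, t) \<in> graph T \<and> fn f t = fn f z"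
      proof (rule modular_permute[where p = "prj W", OF assms(1,2) ObjD(1)[OF W] HomD(7)[OF f] HomD(7)[OF g] inj full _ Tg(2) _ _ xy' yz])
        show "prj W a = prj W b" if "a \<in> elems W" "b \<in> elems W" "fn f a = fn f b" for a b
          using HomD(9)[OF f that(1)] HomD(9)[OF f that(2)] that(3) by simp
        show "(interp (alg W) \<sigma> xs, interp (alg W) \<sigma> ys) \<in> graph T"
          if "length xs = ar \<sigma>" "list_all2 (\<lambda>x y. (x, y) \<in> graph T) xs ys" for \<sigma> xs ys
          using relation_onD(5)[OF Tg(1)] that unfolding compatible_def by blast
        show "prj W a = prj W b" if "(a, b) \<in> graph T" for a b
          using relation_onD(4)[OF Tg(1) that] .
      qed
      moreover have "z \<in> elems W" using yz relation_onD(3)[OF Tg(1)] by auto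
      ultimately show "(x, z) \<in> graph T O graph R" using Rg(2) by auto
    qed
    then have "\<forall>q \<in> elems (Cod C \<zeta>). \<exists>p \<in> elems (Dom C \<zeta>). fn \<zeta> p = q"
      using zeta_surjective_iff(2)[OF Rg(1) Tg(1) \<zeta>] by blast
    then show ?thesis
      using surjective_extremal_epi[OF zeta_surjective_iff(1)[OF Rg(1) Tg(1) \<zeta>]] by blast
  qed
  then show ?thesis
    unfolding axiom_star_def using fibre_pointed_finitely_complete by blast
qed

end
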